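(* For every datalog program $\Pi$, the adornment algorithm (described in the context), run on $\Pi$ with the identity function $\mathit{id}$ as the adornment relaxation function $g$ and $h_{\mathsf{cont}}$ as the membership checking function $h$, terminates if and only if $\Pi$ is bounded.
   Context: Datalog. Standard positive datalog programs: finite sets of rules $q(\bar s)\gets p_1(\bar s_1),\dots,p_\mu(\bar s_\mu)$ whose terms are variables or constants. A predicate is IDB if it is the head predicate of a rule with non-empty body, otherwise EDB. A program is bounded if it is equivalent (same IDB relations on every EDB instance) to a finite non-recursive datalog program. A rule $R_0$ is subsumed by a rule $R_1$ if there is a homomorphism from $R_1$ to $R_0$ whose restriction to the head variables is a variable renaming. Adorned predicates. For an IDB predicate $q$ and a rule $\rho$ (the adornment) with head predicate $q$ and only EDB atoms in the body, $q_\rho$ denotes a new predicate. Adornment algorithm (parameters $g$, $h$). Start with $\Pi'=\emptyset$. Repeat until a fixpoint for $\Pi'$: for each rule $R: q(\bar s)\gets \bigwedge_{i=1}^{\lambda}p_i(\bar s_i)\wedge\mathcal E$ of $\Pi$ ($p_i$ IDB predicates, $\mathcal E$ a conjunction of EDB atoms, $\lambda\ge 0$), and for each choice $(\rho_1,\dots,\rho_\lambda)$ such that for each $i$ some rule of $\Pi'$ has head atom ${p_i}_{\rho_i}(\bar v_i)$: rename variables in these head atoms together with their adornments, obtaining ${p_i}_{\rho_i'}(\bar v_i')$, so that $R$ and all these head atoms are variable-disjoint; write $\rho_i'$ as $p_i(\bar v_i')\gets\mathcal B_i$; let $\sigma$ be a simultaneous most general unifier of $\{(\bar s_i,\bar v_i')\mid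 1\le i\le\lambda\}$ (if none exists, skip this choice); let $\rho_0$ be the rule $q(\sigma(\bar s))\gets\bigwedge_{i}\sigma(\mathcal B_i)\wedge\sigma(\mathcal E)$, let $\rho=g(\rho_0)$, and let $R'$ be $q_\rho(\sigma(\bar s))\gets\bigwedge_i {p_i}_{\rho_i}(\sigma(\bar s_i))\wedge\sigma(\mathcal E)$; if $h(R',\Pi')$ is false, add $R'$ to $\Pi'$. Output $\Pi'$. $\mathit{id}$ leaves $\rho_0$ unchanged. $h_{\mathsf{cont}}(R',\Pi')$, for a rule $R'$ with head predicate $q_\rho$, is true iff either (1) $q_\rho$ is not recursive in $\Pi'$ and there exists a predicate $q_{\rho'}$ (in $\Pi'$) such that $\rho'$ subsumes $\rho$, or (2) $\Pi'$ contains a rule identical to $R'$ up to variable renaming; otherwise it is false.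
   Formalization: Subsumption is mended: the homomorphism must carry head to head but need not be a variable renaming on head variables (it may merge them or send them to constants); read literally, the claim fails for programs with repeated variables or constants in rule heads. *)

theory Defs
  imports Main
begin

section \<open>Datalog\<close>

datatype 'c trm = Var nat | Const 'c

datatype ('p, 'c) atom = Atom (atom_pred: 'p) (atom_args: "'c trm list")

datatype ('p, 'c) rule = Rule (head: "('p, 'c) atom") (body: "('p, 'c) atom list")

fun vars_trm :: "'c trm \<Rightarrow> nat set" where
  "vars_trm (Var x) = {x}"
| "vars_trm (Const c) = {}"

definition vars_atom :: "('p, 'c) atom \<Rightarrow> nat set" where
  "vars_atom a = (\<Union>t \<in> set (atom_args a). vars_trm t)"

definition vars_rule :: "('p, 'c) rule \<Rightarrow> nat set" where
  "vars_rule R = (\<Union>a \<in> insert (head R) (set (body R)). vars_atom a)"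

definition preds :: "('p, 'c) rule set \<Rightarrow> 'p set" where
  "preds P = (\<Union>R \<in> P. atom_pred ` insert (head R) (set (body R)))"

text \<open>A program over the signature with arity function \<open>ar\<close>. Safety is not required: variables
  range over all constants.\<close>

definition datalog_program :: "('p \<Rightarrow> nat) \<Rightarrow> ('p, 'c) rule set \<Rightarrow> bool" where
  "datalog_program ar P \<longleftrightarrow> finite P \<and>
     (\<forall>R \<in> P. \<forall>a \<in> insert (head R) (set (body R)). length (atom_args a) = ar (atom_pred a))"

definition idb :: "('p, 'c) rule set \<Rightarrow> 'p set" where
  "idb P = {atom_pred (head R) | R. R \<in> P \<and> body R \<noteq> []}"

definition edb :: "('p, 'c) rule set \<Rightarrow> 'p set" where
  "edb P = preds P - idb P"

definition depends :: "('p, 'c) rule set \<Rightarrow> 'p \<Rightarrow> 'p \<Rightarrow> bool" where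
  "depends P q p \<longleftrightarrow> (\<exists>R \<in> P. atom_pred (head R) = q \<and> p \<in> atom_pred ` set (body R))"

definition recursive_in :: "('p, 'c) rule set \<Rightarrow> 'p \<Rightarrow> bool" where
  "recursive_in P q \<longleftrightarrow> (depends P)\<^sup>+\<^sup>+ q q"

definition nonrecursive :: "('p, 'c) rule set \<Rightarrow> bool" where
  "nonrecursive P \<longleftrightarrow> (\<forall>q. \<not> recursive_in P q)"


section \<open>Semantics and boundedness\<close>

fun ground_trm :: "(nat \<Rightarrow> 'c) \<Rightarrow> 'c trm \<Rightarrow> 'c" where
  "ground_trm \<nu> (Var x) = \<nu> x"
| "ground_trm \<nu> (Const c) = c"

definition ground_atom :: "(nat \<Rightarrow> 'c) \<Rightarrow> ('p, 'c) atom \<Rightarrow> 'p \<times> 'c list" where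
  "ground_atom \<nu> a = (atom_pred a, map (ground_trm \<nu>) (atom_args a))"

definition instance_over :: "('p \<Rightarrow> nat) \<Rightarrow> 'p set \<Rightarrow> ('p \<times> 'c list) set \<Rightarrow> bool" where
  "instance_over ar E I \<longleftrightarrow> finite I \<and> (\<forall>(p, cs) \<in> I. p \<in> E \<and> length cs = ar p)"

text \<open>The least interpretation that is closed under the rules and whose \<open>E\<close>-relations are those of
  the instance \<open>I\<close>. A predicate that heads only bodiless rules counts as EDB; such rules are data,
  and as the instance interprets the EDB predicates they are replaced by it.\<close>

inductive_set least_interp :: "'p set \<Rightarrow> ('p, 'c) rule set \<Rightarrow> ('p \<times> 'c list) set \<Rightarrow> ('p \<times> 'c list) set"
  for E :: "'p set" and P :: "('p, 'c) rule set" and I :: "('p \<times> 'c list) set" where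
  given: "f \<in> I \<Longrightarrow> f \<in> least_interp E P I"
| derived: "R \<in> P \<Longrightarrow> atom_pred (head R) \<notin> E \<Longrightarrow>
    (\<And>a. a \<in> set (body R) \<Longrightarrow> ground_atom \<nu> a \<in> least_interp E P I) \<Longrightarrow>
    ground_atom \<nu> (head R) \<in> least_interp E P I"

definition equivalent_to :: "('p \<Rightarrow> nat) \<Rightarrow> ('p, 'c) rule set \<Rightarrow> ('p, 'c) rule set \<Rightarrow> bool" where
  "equivalent_to ar P Q \<longleftrightarrow>
     (\<forall>I. instance_over ar (edb P) I \<longrightarrow>
        (\<forall>q \<in> idb P. \<forall>cs. (q, cs) \<in> least_interp (edb P) P I \<longleftrightarrow> (q, cs) \<in> least_interp (edb P) Q I))"

definition bounded_program :: "('p \<Rightarrow> nat) \<Rightarrow> ('p, 'c) rule set \<Rightarrow> bool" where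
  "bounded_program ar P \<longleftrightarrow>
     (\<exists>Q. datalog_program ar Q \<and> nonrecursive Q \<and> equivalent_to ar P Q)"


section \<open>Substitutions, variable renaming, subsumption\<close>

type_synonym 'c subst = "nat \<Rightarrow> 'c trm"

fun subst_trm :: "'c subst \<Rightarrow> 'c trm \<Rightarrow> 'c trm" where
  "subst_trm \<sigma> (Var x) = \<sigma> x"
| "subst_trm \<sigma> (Const c) = Const c"

definition subst_atom :: "'c subst \<Rightarrow> ('p, 'c) atom \<Rightarrow> ('p, 'c) atom" where
  "subst_atom \<sigma> a = Atom (atom_pred a) (map (subst_trm \<sigma>) (atom_args a))"

text \<open>Identity of rules up to variable renaming. Bodies are compared as sets of atoms, since they
  denote conjunctions.\<close>

definition variant :: "('p, 'c) rule \<Rightarrow> ('p, 'c) rule \<Rightarrow> bool" where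
  "variant R S \<longleftrightarrow> (\<exists>\<pi>. bij \<pi> \<and>
     head S = subst_atom (Var \<circ> \<pi>) (head R) \<and>
     set (body S) = subst_atom (Var \<circ> \<pi>) ` set (body R))"

text \<open>\<open>subsumes R1 R0\<close>: the rule \<open>R0\<close> is subsumed by \<open>R1\<close>. The homomorphism carries head to head,
  position by position. If the terms of both heads are pairwise distinct variables, this says that
  it is a variable renaming on the head variables. In general the head terms of \<open>R0\<close> may repeat or
  be constants. If an injective map to variables were required there too, the rule
  \<open>q(x,x,u) \<leftarrow> \<dots>\<close> would never be subsumed by \<open>q(x,y,u) \<leftarrow> E(x,y,u)\<close>, and for the program
  \<open>q(x,y,u) \<leftarrow> E(x,y,u)\<close>,
  \<open>q(x,x,u) \<leftarrow> E(x,x,u), B(u)\<close>,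
  \<open>q(x,y,u) \<leftarrow> E(x,y,u), G(u,v), q(x,y,v)\<close>,
  which is bounded (\<open>q = E\<close>), the algorithm with \<open>h_cont\<close> would then add pairwise incomparable rules
  for \<open>q(x,x,u)\<close> forever.\<close>

definition subsumes :: "('p, 'c) rule \<Rightarrow> ('p, 'c) rule \<Rightarrow> bool" where
  "subsumes R1 R0 \<longleftrightarrow> (\<exists>\<theta>. subst_atom \<theta> (head R1) = head R0 \<and>
     subst_atom \<theta> ` set (body R1) \<subseteq> set (body R0))"

text \<open>Simultaneous unification of pairs of term lists.\<close>

definition unifier :: "'c subst \<Rightarrow> ('c trm list \<times> 'c trm list) set \<Rightarrow> bool" where
  "unifier \<sigma> U \<longleftrightarrow> (\<forall>(s, t) \<in> U. map (subst_trm \<sigma>) s = map (subst_trm \<sigma>) t)"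

definition mgu :: "'c subst \<Rightarrow> ('c trm list \<times> 'c trm list) set \<Rightarrow> bool" where
  "mgu \<sigma> U \<longleftrightarrow> unifier \<sigma> U \<and>
     (\<forall>\<tau>. unifier \<tau> U \<longrightarrow> (\<exists>\<delta>. \<forall>x. \<tau> x = subst_trm \<delta> (\<sigma> x)))"


section \<open>Adornments\<close>

text \<open>Adornments are identified up to variable renaming: the predicate \<open>q\<^sub>\<rho>\<close> is \<open>Adorned q [\<rho>]\<close> with
  \<open>[\<rho>]\<close> the class of all variants of \<open>\<rho>\<close>. EDB predicates stay \<open>Plain\<close>.\<close>

datatype ('p, 'c) apred = Plain 'p | Adorned 'p "('p, 'c) rule set"

type_synonym ('p, 'c) arule = "(('p, 'c) apred, 'c) rule"

definition adornment :: "('p, 'c) rule \<Rightarrow> ('p, 'c) rule set" where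
  "adornment \<rho> = {\<rho>'. variant \<rho> \<rho>'}"

definition idb_atoms :: "('p, 'c) rule set \<Rightarrow> ('p, 'c) rule \<Rightarrow> ('p, 'c) atom list" where
  "idb_atoms P R = filter (\<lambda>a. atom_pred a \<in> idb P) (body R)"

definition edb_atoms :: "('p, 'c) rule set \<Rightarrow> ('p, 'c) rule \<Rightarrow> ('p, 'c) atom list" where
  "edb_atoms P R = filter (\<lambda>a. atom_pred a \<notin> idb P) (body R)"

definition plain_atom :: "('p, 'c) atom \<Rightarrow> (('p, 'c) apred, 'c) atom" where
  "plain_atom a = Atom (Plain (atom_pred a)) (atom_args a)"

definition adorned_atom :: "('p, 'c) rule set \<Rightarrow> ('p, 'c) atom \<Rightarrow> (('p, 'c) apred, 'c) atom" where
  "adorned_atom c a = Atom (Adorned (atom_pred a) c) (atom_args a)"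

text \<open>\<open>cs\<close> lists adornments for the IDB atoms of \<open>R\<close>, in the order of occurrence.\<close>

definition choice ::
  "('p, 'c) rule set \<Rightarrow> ('p, 'c) arule set \<Rightarrow> ('p, 'c) rule \<Rightarrow> ('p, 'c) rule set list \<Rightarrow> bool" where
  "choice P P' R cs \<longleftrightarrow> R \<in> P \<and> length cs = length (idb_atoms P R) \<and>
     (\<forall>i < length cs. \<exists>S \<in> P'. atom_pred (head S) = Adorned (atom_pred (idb_atoms P R ! i)) (cs ! i))"

text \<open>\<open>R'\<close> is a rule obtained from \<open>R\<close> and \<open>cs\<close>, for some way \<open>\<rho>s\<close> of renaming the chosen adornments
  apart and some most general unifier \<open>\<sigma>\<close>. The renamed head atom of the i-th adorned predicate has the
  same arguments as the head of \<open>\<rho>s ! i\<close>.\<close>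

definition adorned_rule ::
  "(('p, 'c) rule \<Rightarrow> ('p, 'c) rule) \<Rightarrow> ('p, 'c) rule set \<Rightarrow> ('p, 'c) rule \<Rightarrow>
   ('p, 'c) rule set list \<Rightarrow> ('p, 'c) arule \<Rightarrow> bool" where
  "adorned_rule g P R cs R' \<longleftrightarrow>
     (\<exists>\<rho>s \<sigma>.
        let as = idb_atoms P R; \<E> = map (subst_atom \<sigma>) (edb_atoms P R);
            \<rho>0 = Rule (subst_atom \<sigma> (head R))
                   (concat (map (\<lambda>\<rho>. map (subst_atom \<sigma>) (body \<rho>)) \<rho>s) @ \<E>);
            \<rho> = g \<rho>0
        in length \<rho>s = length cs \<and> (\<forall>i < length cs. \<rho>s ! i \<in> cs ! i) \<and>
           (\<forall>i < length \<rho>s. vars_rule R \<inter> vars_rule (\<rho>s ! i) = {} \<and>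
              (\<forall>j < i. vars_rule (\<rho>s ! j) \<inter> vars_rule (\<rho>s ! i) = {})) \<and>
           mgu \<sigma> {(atom_args (as ! i), atom_args (head (\<rho>s ! i))) | i. i < length as} \<and>
           R' = Rule (adorned_atom (adornment \<rho>) (subst_atom \<sigma> (head R)))
                  (map2 adorned_atom cs (map (subst_atom \<sigma>) as) @ map plain_atom \<E>))"


section \<open>The adornment algorithm\<close>

definition process ::
  "(('p, 'c) rule \<Rightarrow> ('p, 'c) rule) \<Rightarrow> (('p, 'c) arule \<Rightarrow> ('p, 'c) arule set \<Rightarrow> bool) \<Rightarrow>
   ('p, 'c) rule set \<Rightarrow> ('p, 'c) rule \<Rightarrow> ('p, 'c) rule set list \<Rightarrow>
   ('p, 'c) arule set \<Rightarrow> ('p, 'c) arule set \<Rightarrow> bool" where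
  "process g h P R cs P1 P2 \<longleftrightarrow>
     (\<exists>R'. adorned_rule g P R cs R' \<and> P2 = (if h R' P1 then P1 else insert R' P1)) \<or>
     ((\<nexists>R'. adorned_rule g P R cs R') \<and> P2 = P1)"

text \<open>An execution is the sequence of the values of the adorned program, starting from the empty
  set. The order in which rules and choices are treated is left open, but, as in the repeated loop
  over all of them, each choice that is available at some time is processed at that time or later.
  An execution that has finished is continued by idle steps.\<close>

definition adornment_run ::
  "(('p, 'c) rule \<Rightarrow> ('p, 'c) rule) \<Rightarrow> (('p, 'c) arule \<Rightarrow> ('p, 'c) arule set \<Rightarrow> bool) \<Rightarrow>
   ('p, 'c) rule set \<Rightarrow> (nat \<Rightarrow> ('p, 'c) arule set) \<Rightarrow> bool" where
  "adornment_run g h P r \<longleftrightarrow>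
     r 0 = {} \<and>
     (\<forall>n. r (Suc n) = r n \<or> (\<exists>R cs. choice P (r n) R cs \<and> process g h P R cs (r n) (r (Suc n)))) \<and>
     (\<forall>n R cs. choice P (r n) R cs \<longrightarrow> (\<exists>m \<ge> n. process g h P R cs (r m) (r (Suc m))))"

definition terminates :: "(nat \<Rightarrow> ('p, 'c) arule set) \<Rightarrow> bool" where
  "terminates r \<longleftrightarrow> (\<exists>N. \<forall>n \<ge> N. r n = r N)"

definition h_cont :: "('p, 'c) arule \<Rightarrow> ('p, 'c) arule set \<Rightarrow> bool" where
  "h_cont R' P' \<longleftrightarrow>
     (\<exists>q c. atom_pred (head R') = Adorned q c \<and> \<not> recursive_in P' (Adorned q c) \<and>
        (\<exists>c'. Adorned q c' \<in> preds P' \<and> (\<exists>\<rho>' \<in> c'. \<exists>\<rho> \<in> c. subsumes \<rho>' \<rho>))) \<or>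
     (\<exists>S \<in> P'. variant S R')"

end

theory Submission
  imports Defs
begin

text \<open>With the identity as relaxation function the adorned program never becomes recursive: a new
  predicate is added only if its adornment is not subsumed by an earlier one, hence it is fresh.
  So \<open>h_cont\<close> just tests subsumption by an earlier adornment. Adornments are expansions
  of the program, and by fairness every derivation is eventually matched by some adornment.

  If the run stops, its finitely many adornments form an equivalent nonrecursive program.
  Conversely, a nonrecursive program derives each fact from a bounded number \<open>k\<close> of EDB facts.
  Freezing an expansion \<open>\<rho>\<close>, its head follows already from \<open>k\<close> of its body atoms, so the subrule
  with these atoms is eventually subsumed by an adornment. Up to renaming there are finitely many
  such subrules. Once all of them are subsumed, nothing new is added.\<close>

section \<open>Substitutions and ground instances\<close>

text \<open>The run \<open>r\<close> is arbitrary: order, representatives of adornments and unifiers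
  are left open, so soundness and completeness are stated through what adornments derive
  (\<open>fires\<close>). Fairness does not make every resolvent appear, since \<open>h_cont\<close>
  may reject it. What survives rejection is being \<open>covered\<close>, which is monotone along
  the run. A subrule of an expansion with at most k atoms need not be an expansion. Reading this
  match as a homomorphism needs frozen constants apart from those of the program, hence the infinite
  supply of constants, and adornments without foreign constants, hence \<open>mgu_constants\<close>.
  The stage at which a short subrule is covered depends on the subrule; finiteness up to renaming
  yields one stage for all.\<close>

lemma atom_pred_subst [simp]: "atom_pred (subst_atom \<sigma> a) = atom_pred a"
  by (simp add: subst_atom_def)

lemma atom_args_subst [simp]: "atom_args (subst_atom \<sigma> a) = map (subst_trm \<sigma>) (atom_args a)"
  by (simp add: subst_atom_def)

lemma fst_ground_atom [simp]: "fst (ground_atom \<nu> a) = atom_pred a"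
  by (simp add: ground_atom_def)

lemma subst_trm_subst: "subst_trm \<delta> (subst_trm \<sigma> t) = subst_trm (\<lambda>x. subst_trm \<delta> (\<sigma> x)) t"
  by (cases t) auto

lemma subst_atom_subst: "subst_atom \<delta> (subst_atom \<sigma> a) = subst_atom (\<lambda>x. subst_trm \<delta> (\<sigma> x)) a"
  by (simp add: subst_atom_def subst_trm_subst)

lemma subst_trm_cong: "(\<And>x. x \<in> vars_trm t \<Longrightarrow> \<sigma> x = \<tau> x) \<Longrightarrow> subst_trm \<sigma> t = subst_trm \<tau> t"
  by (cases t) auto

lemma subst_atom_cong:
  "(\<And>x. x \<in> vars_atom a \<Longrightarrow> \<sigma> x = \<tau> x) \<Longrightarrow> subst_atom \<sigma> a = subst_atom \<tau> a"
  by (auto simp: subst_atom_def vars_atom_def intro!: subst_trm_cong)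

lemma subst_trm_Var [simp]: "subst_trm Var t = t"
  by (cases t) auto

lemma subst_atom_Var [simp]: "subst_atom Var a = a"
  by (cases a) (simp add: subst_atom_def map_idI)

lemma ground_trm_subst:
  "ground_trm \<nu> (subst_trm \<sigma> t) = ground_trm (\<lambda>x. ground_trm \<nu> (\<sigma> x)) t"
  by (cases t) auto

lemma ground_atom_subst:
  "ground_atom \<nu> (subst_atom \<sigma> a) = ground_atom (\<lambda>x. ground_trm \<nu> (\<sigma> x)) a"
  by (simp add: ground_atom_def ground_trm_subst)

lemma ground_trm_cong:
  "(\<And>x. x \<in> vars_trm t \<Longrightarrow> \<mu> x = \<nu> x) \<Longrightarrow> ground_trm \<mu> t = ground_trm \<nu> t"
  by (cases t) auto

lemma ground_atom_cong:
  "(\<And>x. x \<in> vars_atom a \<Longrightarrow> \<mu> x = \<nu> x) \<Longrightarrow> ground_atom \<mu> a = ground_atom \<nu> a"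
  by (auto simp: ground_atom_def vars_atom_def intro!: ground_trm_cong)

lemma subst_trm_Const: "subst_trm (\<lambda>x. Const (\<mu> x)) t = Const (ground_trm \<mu> t)"
  by (cases t) auto

lemma vars_trm_subst_Var: "vars_trm (subst_trm (Var \<circ> \<pi>) t) = \<pi> ` vars_trm t"
  by (cases t) auto

lemma vars_atom_subst_Var: "vars_atom (subst_atom (Var \<circ> \<pi>) a) = \<pi> ` vars_atom a"
  by (auto simp: vars_atom_def vars_trm_subst_Var)

lemma set_trm_subst:
  assumes "set_trm t \<subseteq> C" "\<And>x. set_trm (\<sigma> x) \<subseteq> C"
  shows "set_trm (subst_trm \<sigma> t) \<subseteq> C"
  using assms by (cases t) auto

lemma set2_atom_alt: "set2_atom a = (\<Union>t \<in> set (atom_args a). set_trm t)"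
  by (cases a) simp

lemma set2_atom_subst:
  assumes "set2_atom a \<subseteq> C" "\<And>x. set_trm (\<sigma> x) \<subseteq> C"
  shows "set2_atom (subst_atom \<sigma> a) \<subseteq> C"
  using assms set_trm_subst[of _ C \<sigma>] by (simp add: set2_atom_alt SUP_le_iff)

lemma finite_vars_trm [simp]: "finite (vars_trm t)"
  by (cases t) auto

lemma finite_vars_rule [simp]: "finite (vars_rule R)"
  by (auto simp: vars_rule_def vars_atom_def)

lemma card_vars_atom_le:
  fixes a :: "('p, 'c) atom"
  shows "card (vars_atom a) \<le> length (atom_args a)"
proof -
  have "card (vars_atom a) \<le> (\<Sum>t \<in> set (atom_args a). card (vars_trm t))"
    unfolding vars_atom_def by (rule card_UN_le) simp
  also have "\<dots> \<le> (\<Sum>t \<in> set (atom_args a). 1)"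
  proof (rule sum_mono)
    show "card (vars_trm t) \<le> 1" for t :: "'c trm" by (cases t) auto
  qed
  also have "\<dots> \<le> length (atom_args a)"
    by (simp add: card_length)
  finally show ?thesis .
qed

lemma card_vars_rule_le:
  assumes "\<And>a. a \<in> insert (head R) (set (body R)) \<Longrightarrow> length (atom_args a) \<le> L"
  shows "card (vars_rule R) \<le> Suc (length (body R)) * L"
proof -
  let ?A = "insert (head R) (set (body R))"
  have "card (vars_rule R) \<le> (\<Sum>a \<in> ?A. card (vars_atom a))"
    unfolding vars_rule_def by (rule card_UN_le) simp
  also have "\<dots> \<le> (\<Sum>a \<in> ?A. L)"
    by (rule sum_mono) (rule order_trans[OF card_vars_atom_le assms])
  also have "\<dots> = card ?A * L" by simp
  also have "\<dots> \<le> Suc (length (body R)) * L"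
  proof (rule mult_right_mono)
    show "card ?A \<le> Suc (length (body R))"
      using card_length[of "body R"] by (auto simp: card_insert_if)
  qed simp
  finally show ?thesis .
qed


section \<open>Most general unifiers\<close>

text \<open>Without function symbols a pair of terms is solved by binding one variable to the other
  side, with no occurs check. Every unifier of the pair is unchanged by composing it after this
  binding, so it also unifies the remaining pairs once they are instantiated, and induction on their
  number applies.\<close>

lemma mgu_exists_trm:
  assumes "unifier \<tau> ((\<lambda>(s, t). ([s], [t])) ` set E)"
  shows "\<exists>\<sigma>. mgu \<sigma> ((\<lambda>(s, t). ([s], [t])) ` set E)"
  using assms
proof (induction "length E" arbitrary: E \<tau>)
  case 0
  then show ?case
    by (intro exI[of _ Var]) (auto simp: mgu_def unifier_def)
next
  case (Suc n)
  let ?U = "\<lambda>E. (\<lambda>(s, t). ([s], [t])) ` set E"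
  from Suc.hyps(2) obtain s t E' where E: "E = (s, t) # E'"
    by (cases E) auto
  have uni: "unifier \<upsilon> (?U E) \<longleftrightarrow> subst_trm \<upsilon> s = subst_trm \<upsilon> t \<and>
      (\<forall>(u, v) \<in> set E'. subst_trm \<upsilon> u = subst_trm \<upsilon> v)" for \<upsilon>
    by (auto simp: unifier_def E)
  have "\<exists>\<sigma>1. subst_trm \<sigma>1 s = subst_trm \<sigma>1 t \<and>
      (\<forall>\<upsilon>. subst_trm \<upsilon> s = subst_trm \<upsilon> t \<longrightarrow> (\<forall>x. \<upsilon> x = subst_trm \<upsilon> (\<sigma>1 x)))"
  proof (cases "\<exists>x. s = Var x \<or> t = Var x")
    case True
    then obtain x u where "s = Var x \<and> t = u \<or> s = u \<and> t = Var x" by blast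
    then show ?thesis
      by (intro exI[of _ "Var(x := u)"]) (cases u; auto)
  next
    case False
    \<comment> \<open>Two constants: the given unifier excludes a clash.\<close>
    moreover have "subst_trm \<tau> s = subst_trm \<tau> t"
      using Suc.prems uni by blast
    ultimately have "s = t" by (cases s; cases t) auto
    then show ?thesis by (intro exI[of _ Var]) auto
  qed
  then obtain \<sigma>1 where \<sigma>1: "subst_trm \<sigma>1 s = subst_trm \<sigma>1 t"
    and gen1: "\<And>\<upsilon> x. subst_trm \<upsilon> s = subst_trm \<upsilon> t \<Longrightarrow> \<upsilon> x = subst_trm \<upsilon> (\<sigma>1 x)"
    by blast
  define E1 where "E1 = map (\<lambda>(u, v). (subst_trm \<sigma>1 u, subst_trm \<sigma>1 v)) E'"
  have uni1: "unifier \<upsilon> (?U E1)" if "unifier \<upsilon> (?U E)" for \<upsilon>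
  proof -
    have "(\<lambda>x. subst_trm \<upsilon> (\<sigma>1 x)) = \<upsilon>"
      using that unfolding uni by (intro ext gen1[symmetric]) blast
    then show ?thesis
      using that unfolding uni by (auto simp: unifier_def E1_def subst_trm_subst)
  qed
  have "length E1 = n"
    using Suc.hyps(2) by (simp add: E E1_def)
  then obtain \<sigma>2 where \<sigma>2: "mgu \<sigma>2 (?U E1)"
    using Suc.hyps(1)[OF _ uni1[OF Suc.prems]] by blast
  have "mgu (\<lambda>x. subst_trm \<sigma>2 (\<sigma>1 x)) (?U E)"
    unfolding mgu_def
  proof (intro conjI allI impI)
    have "subst_trm \<sigma>2 (subst_trm \<sigma>1 u) = subst_trm \<sigma>2 (subst_trm \<sigma>1 v)"
      if "(u, v) \<in> set E'" for u v
      using \<sigma>2 that by (force simp: mgu_def unifier_def E1_def)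
    then show "unifier (\<lambda>x. subst_trm \<sigma>2 (\<sigma>1 x)) (?U E)"
      unfolding uni using \<sigma>1 by (auto simp flip: subst_trm_subst)
    fix \<upsilon> assume \<upsilon>: "unifier \<upsilon> (?U E)"
    then obtain \<delta> where \<delta>: "\<And>x. \<upsilon> x = subst_trm \<delta> (\<sigma>2 x)"
      using \<sigma>2 uni1[OF \<upsilon>] unfolding mgu_def by blast
    have "\<upsilon> x = subst_trm \<delta> (subst_trm \<sigma>2 (\<sigma>1 x))" for x
    proof -
      have "\<upsilon> x = subst_trm \<upsilon> (\<sigma>1 x)"
        using \<upsilon> uni gen1 by blast
      also have "\<dots> = subst_trm \<delta> (subst_trm \<sigma>2 (\<sigma>1 x))"
        unfolding subst_trm_subst by (rule subst_trm_cong) (rule \<delta>)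
      finally show ?thesis .
    qed
    then show "\<exists>\<delta>. \<forall>x. \<upsilon> x = subst_trm \<delta> (subst_trm \<sigma>2 (\<sigma>1 x))" by blast
  qed
  then show ?case by blast
qed

text \<open>\<open>zip\<close> drops surplus terms, so the reduction to pairs of single terms needs
  equal lengths. The given unifier provides them.\<close>

lemma mgu_exists:
  assumes "finite U" "unifier \<tau> U"
  shows "\<exists>\<sigma>. mgu \<sigma> U"
proof -
  have "finite (\<Union>(s, t) \<in> U. set (zip s t))"
    using assms(1) by auto
  from finite_list[OF this] obtain E where E: "set E = (\<Union>(s, t) \<in> U. set (zip s t))" ..
  have len: "length s = length t" if "(s, t) \<in> U" for s t
    using assms(2) that map_eq_imp_length_eq unfolding unifier_def by blast
  have eq: "map f s = map f t \<longleftrightarrow> (\<forall>(u, v) \<in> set (zip s t). f u = f v)"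
    if "length s = length t" for s t :: "'a trm list" and f :: "'a trm \<Rightarrow> 'a trm"
    using that by (induction s t rule: list_induct2) auto
  have "unifier \<upsilon> U \<longleftrightarrow> unifier \<upsilon> ((\<lambda>(s, t). ([s], [t])) ` set E)" for \<upsilon>
  proof -
    have "unifier \<upsilon> U \<longleftrightarrow>
        (\<forall>s t. (s, t) \<in> U \<longrightarrow> map (subst_trm \<upsilon>) s = map (subst_trm \<upsilon>) t)"
      by (auto simp: unifier_def)
    also have "\<dots> \<longleftrightarrow> (\<forall>s t. (s, t) \<in> U \<longrightarrow>
        (\<forall>(u, v) \<in> set (zip s t). subst_trm \<upsilon> u = subst_trm \<upsilon> v))"
      by (intro all_cong1 imp_cong refl eq len)
    also have "\<dots> \<longleftrightarrow> (\<forall>(u, v) \<in> set E. subst_trm \<upsilon> u = subst_trm \<upsilon> v)"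
      unfolding E by blast
    also have "\<dots> \<longleftrightarrow> unifier \<upsilon> ((\<lambda>(s, t). ([s], [t])) ` set E)"
      by (auto simp: unifier_def)
    finally show ?thesis .
  qed
  then have "mgu \<sigma> U \<longleftrightarrow> mgu \<sigma> ((\<lambda>(s, t). ([s], [t])) ` set E)"
    "unifier \<tau> ((\<lambda>(s, t). ([s], [t])) ` set E)" for \<sigma>
    using assms(2) unfolding mgu_def by blast+
  then show ?thesis
    using mgu_exists_trm by blast
qed

text \<open>Replacing all constants outside \<open>C\<close> by a variable turns \<sigma> into
  another unifier, because the terms of \<open>U\<close> contain no such constant. It would have to
  factor through \<sigma>, but no substitution sends \<open>Const d\<close> to a variable.\<close>

lemma mgu_constants:
  assumes "mgu \<sigma> U"
    and "\<And>s t u. (s, t) \<in> U \<Longrightarrow> u \<in> set s \<union> set t \<Longrightarrow> set_trm u \<subseteq> C"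
  shows "set_trm (\<sigma> x) \<subseteq> C"
proof (rule ccontr)
  assume "\<not> set_trm (\<sigma> x) \<subseteq> C"
  then obtain d where d: "\<sigma> x = Const d" "d \<notin> C"
    by (cases "\<sigma> x") auto
  define erase where "erase t = (if set_trm t \<subseteq> C then t else Var 0)" for t :: "'a trm"
  have erase: "erase (subst_trm \<sigma> t) = subst_trm (\<lambda>x. erase (\<sigma> x)) t" if "set_trm t \<subseteq> C" for t
    using that by (cases t) (auto simp: erase_def)
  have "unifier (\<lambda>x. erase (\<sigma> x)) U"
    unfolding unifier_def
  proof clarify
    fix s t assume st: "(s, t) \<in> U"
    have "map (subst_trm \<sigma>) s = map (subst_trm \<sigma>) t"
      using assms(1) st by (auto simp: mgu_def unifier_def)
    then have "map erase (map (subst_trm \<sigma>) s) = map erase (map (subst_trm \<sigma>) t)"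
      by simp
    moreover have "map erase (map (subst_trm \<sigma>) u) = map (subst_trm (\<lambda>x. erase (\<sigma> x))) u"
      if "u = s \<or> u = t" for u
      using assms(2)[OF st] that by (auto intro!: erase)
    ultimately show "map (subst_trm (\<lambda>x. erase (\<sigma> x))) s = map (subst_trm (\<lambda>x. erase (\<sigma> x))) t"
      by metis
  qed
  then obtain \<delta> where "erase (\<sigma> x) = subst_trm \<delta> (\<sigma> x)"
    using assms(1) by (auto simp: mgu_def)
  with d show False by (simp add: erase_def)
qed


section \<open>Subsumption and variants\<close>

lemma subsumes_refl: "subsumes R R"
  unfolding subsumes_def by (intro exI[of _ Var]) auto

lemma subsumes_trans:
  assumes "subsumes R S" "subsumes S T"
  shows "subsumes R T"
proof -
  obtain \<theta> \<theta>' where "subst_atom \<theta> (head R) = head S" "subst_atom \<theta> ` set (body R) \<subseteq> set (body S)"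
    "subst_atom \<theta>' (head S) = head T" "subst_atom \<theta>' ` set (body S) \<subseteq> set (body T)"
    using assms by (auto simp: subsumes_def)
  then show ?thesis
    unfolding subsumes_def
    by (intro exI[of _ "\<lambda>x. subst_trm \<theta>' (\<theta> x)"]) (auto simp flip: subst_atom_subst)
qed

lemma variant_refl: "variant R R"
  unfolding variant_def by (intro exI[of _ id]) auto

lemma variant_sym:
  assumes "variant R S"
  shows "variant S R"
proof -
  obtain \<pi> where \<pi>: "bij \<pi>" "head S = subst_atom (Var \<circ> \<pi>) (head R)"
    "set (body S) = subst_atom (Var \<circ> \<pi>) ` set (body R)"
    using assms by (auto simp: variant_def)
  have inv: "subst_atom (Var \<circ> inv \<pi>) (subst_atom (Var \<circ> \<pi>) a) = a" for a :: "('a, 'b) atom"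
  proof -
    have "(\<lambda>x. subst_trm (Var \<circ> inv \<pi>) ((Var \<circ> \<pi>) x)) = (Var :: nat \<Rightarrow> 'b trm)"
      using \<pi>(1) by (auto simp: bij_is_inj)
    then show ?thesis by (simp only: subst_atom_subst subst_atom_Var)
  qed
  show ?thesis
    unfolding variant_def
    by (intro exI[of _ "inv \<pi>"]) (use \<pi> inv in \<open>simp add: bij_imp_bij_inv image_image\<close>)
qed

lemma variant_subsumes: "variant R S \<Longrightarrow> subsumes R S"
  by (auto simp: variant_def subsumes_def)

lemma variant_apart:
  assumes "finite V"
  shows "\<exists>S. variant R S \<and> V \<inter> vars_rule S = {}"
proof -
  have "finite (vars_rule R \<union> V)" using assms by simp
  then obtain m where m: "\<And>x. x \<in> vars_rule R \<union> V \<Longrightarrow> x < m"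
    by (meson finite_nat_set_iff_bounded)
  \<comment> \<open>\<open>variant\<close> asks for a bijection of all naturals, so the shift by
    \<open>m\<close> is completed to the involution that swaps [0, m) with [m, 2m).\<close>
  define \<pi> where "\<pi> x = (if x < m then x + m else if x < 2 * m then x - m else x)" for x
  have "\<pi> (\<pi> x) = x" for x by (auto simp: \<pi>_def)
  then have "bij \<pi>" by (intro o_bij[of \<pi> \<pi>]) auto
  let ?S = "Rule (subst_atom (Var \<circ> \<pi>) (head R)) (map (subst_atom (Var \<circ> \<pi>)) (body R))"
  have "variant R ?S"
    using \<open>bij \<pi>\<close> unfolding variant_def by auto
  moreover have "vars_rule ?S = \<pi> ` vars_rule R"
    unfolding vars_rule_def by (auto simp: vars_atom_subst_Var)
  then have "V \<inter> vars_rule ?S = {}"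
    using m by (fastforce simp: \<pi>_def)
  ultimately show ?thesis by blast
qed

lemma variants_apart:
  assumes "finite V"
  shows "\<exists>Ss. length Ss = length Rs \<and> (\<forall>i < length Rs. variant (Rs ! i) (Ss ! i)) \<and>
    (\<forall>i < length Rs. V \<inter> vars_rule (Ss ! i) = {} \<and>
       (\<forall>j < i. vars_rule (Ss ! j) \<inter> vars_rule (Ss ! i) = {}))"
  using assms
proof (induction Rs arbitrary: V)
  case Nil
  then show ?case by simp
next
  case (Cons R Rs)
  obtain S where S: "variant R S" "V \<inter> vars_rule S = {}"
    using variant_apart[OF Cons.prems] by blast
  obtain Ss where Ss: "length Ss = length Rs" "\<forall>i < length Rs. variant (Rs ! i) (Ss ! i)"
    "\<forall>i < length Rs. (V \<union> vars_rule S) \<inter> vars_rule (Ss ! i) = {} \<and>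
       (\<forall>j < i. vars_rule (Ss ! j) \<inter> vars_rule (Ss ! i) = {})"
    using Cons.IH[of "V \<union> vars_rule S"] Cons.prems by auto
  have "\<forall>i < length (R # Rs). variant ((R # Rs) ! i) ((S # Ss) ! i)"
    using S Ss by (auto simp: nth_Cons split: nat.split)
  moreover have "\<forall>i < length (R # Rs). V \<inter> vars_rule ((S # Ss) ! i) = {} \<and>
       (\<forall>j < i. vars_rule ((S # Ss) ! j) \<inter> vars_rule ((S # Ss) ! i) = {})"
    using S(2) Ss(3) by (simp add: All_less_Suc2 Int_Un_distrib2)
  ultimately show ?case
    using Ss(1) by (intro exI[of _ "S # Ss"]) simp
qed

section \<open>Rules as conjunctive queries\<close>

definition fires :: "('p, 'c) rule \<Rightarrow> ('p \<times> 'c list) set \<Rightarrow> 'p \<times> 'c list \<Rightarrow> bool" where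
  "fires \<rho> I f \<longleftrightarrow> (\<exists>\<nu>. ground_atom \<nu> (head \<rho>) = f \<and> ground_atom \<nu> ` set (body \<rho>) \<subseteq> I)"

text \<open>Compose the homomorphism with the valuation: this is the easy half of the homomorphism
  criterion for containment of conjunctive queries. Freezing supplies the other half later.\<close>

lemma fires_subsumes:
  assumes "subsumes R S" "fires S I f"
  shows "fires R I f"
proof -
  obtain \<theta> \<nu> where "subst_atom \<theta> (head R) = head S" "subst_atom \<theta> ` set (body R) \<subseteq> set (body S)"
    "ground_atom \<nu> (head S) = f" "ground_atom \<nu> ` set (body S) \<subseteq> I"
    using assms by (auto simp: subsumes_def fires_def)
  then show ?thesis
    unfolding fires_def
    by (intro exI[of _ "\<lambda>x. ground_trm \<nu> (\<theta> x)"]) (auto simp flip: ground_atom_subst)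
qed

section \<open>Adorned programs\<close>

definition constants :: "('p, 'c) rule set \<Rightarrow> 'c set" where
  "constants P = (\<Union>R \<in> P. \<Union>a \<in> insert (head R) (set (body R)). set2_atom a)"

text \<open>Soundness is required semantically, through \<open>fires\<close>, instead of through an
  unfolding tree. Heads in \<open>edb P\<close> are treated apart: the algorithm also processes the
  bodiless rules of such predicates, but \<open>least_interp\<close> does not apply them, so
  soundness can fail there and the empty body takes its place.\<close>

definition expansion :: "('p \<Rightarrow> nat) \<Rightarrow> ('p, 'c) rule set \<Rightarrow> ('p, 'c) rule \<Rightarrow> bool" where
  "expansion ar P \<rho> \<longleftrightarrow>
     atom_pred (head \<rho>) \<in> preds P \<and> atom_pred ` set (body \<rho>) \<subseteq> edb P \<and>
     (\<forall>a \<in> insert (head \<rho>) (set (body \<rho>)).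
        length (atom_args a) = ar (atom_pred a) \<and> set2_atom a \<subseteq> constants P) \<and>
     (atom_pred (head \<rho>) \<in> edb P \<longrightarrow> body \<rho> = []) \<and>
     (atom_pred (head \<rho>) \<notin> edb P \<longrightarrow> (\<forall>I f. fires \<rho> I f \<longrightarrow> f \<in> least_interp (edb P) P I))"

lemma expansion_variant:
  assumes "expansion ar P \<rho>" "variant \<rho> \<rho>'"
  shows "expansion ar P \<rho>'"
proof -
  obtain \<pi> where \<pi>: "head \<rho>' = subst_atom (Var \<circ> \<pi>) (head \<rho>)"
    "set (body \<rho>') = subst_atom (Var \<circ> \<pi>) ` set (body \<rho>)"
    using assms(2) by (auto simp: variant_def)
  have "set2_atom (subst_atom (Var \<circ> \<pi>) a) \<subseteq> constants P" if "set2_atom a \<subseteq> constants P"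
    for a :: "('a, 'b) atom"
    by (rule set2_atom_subst[OF that]) simp
  moreover have "fires \<rho> I f" if "fires \<rho>' I f" for I f
    using fires_subsumes[OF variant_subsumes[OF assms(2)] that] .
  moreover have "body \<rho>' = [] \<longleftrightarrow> body \<rho> = []"
    using \<pi>(2) by (metis image_is_empty set_empty)
  ultimately show ?thesis
    using assms(1) unfolding expansion_def \<pi> by auto
qed

definition derived_rules :: "('p, 'c) arule set \<Rightarrow> ('p, 'c) rule set" where
  "derived_rules S = {\<rho>. \<exists>q c. Adorned q c \<in> preds S \<and> \<rho> \<in> c}"

definition covered :: "('p, 'c) arule set \<Rightarrow> ('p, 'c) rule \<Rightarrow> bool" where
  "covered S \<rho> \<longleftrightarrow> (\<exists>\<rho>' \<in> derived_rules S. subsumes \<rho>' \<rho>)"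

text \<open>\<open>choice\<close> looks for heads, whereas \<open>h_cont\<close> and
  \<open>derived_rules\<close> look at all predicates that occur. The last conjunct bridges the
  two.\<close>

definition adorned_program ::
  "('p \<Rightarrow> nat) \<Rightarrow> ('p, 'c) rule set \<Rightarrow> ('p, 'c) arule set \<Rightarrow> bool" where
  "adorned_program ar P S \<longleftrightarrow> finite S \<and> nonrecursive S \<and>
     (\<forall>q c. Adorned q c \<in> preds S \<longrightarrow>
        (\<exists>\<rho>. atom_pred (head \<rho>) = q \<and> c = adornment \<rho> \<and> expansion ar P \<rho>) \<and>
        (\<exists>R \<in> S. atom_pred (head R) = Adorned q c))"

lemma preds_mono: "S \<subseteq> T \<Longrightarrow> preds S \<subseteq> preds T"
  by (auto simp: preds_def)

lemma derived_rules_mono: "S \<subseteq> T \<Longrightarrow> derived_rules S \<subseteq> derived_rules T"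
  using preds_mono[of S T] by (auto simp: derived_rules_def)

lemma covered_mono: "covered S \<rho> \<Longrightarrow> S \<subseteq> T \<Longrightarrow> covered T \<rho>"
  using derived_rules_mono[of S T] by (auto simp: covered_def)

lemma covered_subsumes: "covered S \<rho> \<Longrightarrow> subsumes \<rho> \<rho>' \<Longrightarrow> covered S \<rho>'"
  using subsumes_trans by (auto simp: covered_def)

lemma adorned_classD:
  assumes "adorned_program ar P S" "Adorned q c \<in> preds S" "\<rho> \<in> c"
  shows "expansion ar P \<rho>" "atom_pred (head \<rho>) = q"
proof -
  obtain \<rho>0 where "atom_pred (head \<rho>0) = q" "expansion ar P \<rho>0" "variant \<rho>0 \<rho>"
    using assms by (auto simp: adorned_program_def adornment_def)
  then show "expansion ar P \<rho>" "atom_pred (head \<rho>) = q"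
    using expansion_variant by (blast, auto simp: variant_def)
qed

lemma adorned_class_subsumes:
  assumes "adorned_program ar P S" "Adorned q c \<in> preds S" "\<rho> \<in> c" "\<rho>' \<in> c"
  shows "subsumes \<rho> \<rho>'"
proof -
  obtain \<rho>0 where "c = adornment \<rho>0"
    using assms by (auto simp: adorned_program_def)
  then show ?thesis
    using assms(3,4) subsumes_trans[OF variant_subsumes[OF variant_sym] variant_subsumes]
    by (auto simp: adornment_def)
qed

lemma derived_expansion:
  "adorned_program ar P S \<Longrightarrow> \<rho> \<in> derived_rules S \<Longrightarrow> expansion ar P \<rho>"
  by (auto simp: derived_rules_def adorned_classD(1))

text \<open>Clause (2) of \<open>h_cont\<close> is absorbed: a variant of \<open>R'\<close> in
  \<open>S\<close> carries the same adorned predicate, and \<rho> subsumes itself. For clause (1),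
  subsumption preserves the head predicate, so a covering adornment belongs to the right
  \<open>q\<close>, and it is insensitive to the choice of representatives.\<close>

lemma h_cont_iff_covered:
  assumes S: "adorned_program ar P S"
    and R': "atom_pred (head R') = Adorned (atom_pred (head \<rho>)) (adornment \<rho>)"
  shows "h_cont R' S \<longleftrightarrow> covered S \<rho>"
proof
  assume "h_cont R' S"
  then consider q c' \<rho>' \<rho>1 where "Adorned q c' \<in> preds S" "\<rho>' \<in> c'" "\<rho>1 \<in> adornment \<rho>" "subsumes \<rho>' \<rho>1"
    | T where "T \<in> S" "variant T R'"
    using R' by (auto simp: h_cont_def)
  then show "covered S \<rho>"
  proof cases
    case 1
    then have "subsumes \<rho>1 \<rho>"
      by (simp add: adornment_def variant_subsumes variant_sym)
    then show ?thesis
      using 1 subsumes_trans by (fastforce simp: covered_def derived_rules_def)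
  next
    case 2
    then have "Adorned (atom_pred (head \<rho>)) (adornment \<rho>) \<in> preds S"
      using R' by (force simp: preds_def variant_def)
    moreover have "\<rho> \<in> adornment \<rho>"
      by (simp add: adornment_def variant_refl)
    ultimately show ?thesis
      using subsumes_refl by (auto simp: covered_def derived_rules_def)
  qed
next
  assume "covered S \<rho>"
  then obtain q c' \<rho>' where \<rho>': "Adorned q c' \<in> preds S" "\<rho>' \<in> c'" "subsumes \<rho>' \<rho>"
    by (auto simp: covered_def derived_rules_def)
  have "atom_pred (head \<rho>') = q"
    using adorned_classD(2)[OF S \<rho>'(1,2)] .
  then have "q = atom_pred (head \<rho>)"
    using \<rho>'(3) atom_pred_subst unfolding subsumes_def by metis
  moreover have "\<rho> \<in> adornment \<rho>"
    by (simp add: adornment_def variant_refl)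
  moreover have "\<not> recursive_in S (Adorned (atom_pred (head \<rho>)) (adornment \<rho>))"
    using S by (simp add: adorned_program_def nonrecursive_def)
  ultimately show "h_cont R' S"
    using R' \<rho>' unfolding h_cont_def by blast
qed

definition resolvent ::
  "('p, 'c) rule set \<Rightarrow> ('p, 'c) rule \<Rightarrow> ('p, 'c) rule set list \<Rightarrow> ('p, 'c) rule \<Rightarrow> bool" where
  "resolvent P R cs \<rho> \<longleftrightarrow> (\<exists>\<rho>s \<sigma>.
     length \<rho>s = length cs \<and> (\<forall>i < length cs. \<rho>s ! i \<in> cs ! i) \<and>
     (\<forall>i < length \<rho>s. vars_rule R \<inter> vars_rule (\<rho>s ! i) = {} \<and>
        (\<forall>j < i. vars_rule (\<rho>s ! j) \<inter> vars_rule (\<rho>s ! i) = {})) \<and>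
     mgu \<sigma> {(atom_args (idb_atoms P R ! i), atom_args (head (\<rho>s ! i))) | i. i < length (idb_atoms P R)} \<and>
     \<rho> = Rule (subst_atom \<sigma> (head R))
       (concat (map (\<lambda>\<rho>. map (subst_atom \<sigma>) (body \<rho>)) \<rho>s) @ map (subst_atom \<sigma>) (edb_atoms P R)))"

text \<open>\<open>resolvent\<close> is the rule called \<open>\<rho>0\<close> in the algorithm,
  freed of adorned predicates. By the last fact the body of \<open>R'\<close> mentions only chosen
  adornments, so the head predicate is the only adorned one that can be new.\<close>

lemma adorned_ruleE:
  assumes "adorned_rule id P R cs R'" "length cs = length (idb_atoms P R)"
  obtains \<rho> where "resolvent P R cs \<rho>"
    "atom_pred (head R') = Adorned (atom_pred (head \<rho>)) (adornment \<rho>)"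
    "\<And>p c. Adorned p c \<in> atom_pred ` set (body R') \<Longrightarrow>
       \<exists>i < length cs. p = atom_pred (idb_atoms P R ! i) \<and> c = cs ! i"
proof -
  define as where "as = idb_atoms P R"
  obtain \<rho>s \<sigma> where *: "length \<rho>s = length cs" "\<forall>i < length cs. \<rho>s ! i \<in> cs ! i"
     "\<forall>i < length \<rho>s. vars_rule R \<inter> vars_rule (\<rho>s ! i) = {} \<and>
        (\<forall>j < i. vars_rule (\<rho>s ! j) \<inter> vars_rule (\<rho>s ! i) = {})"
     "mgu \<sigma> {(atom_args (as ! i), atom_args (head (\<rho>s ! i))) | i. i < length as}"
     and R': "R' = Rule (adorned_atom (adornment (Rule (subst_atom \<sigma> (head R))
       (concat (map (\<lambda>\<rho>. map (subst_atom \<sigma>) (body \<rho>)) \<rho>s) @ map (subst_atom \<sigma>) (edb_atoms P R))))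
         (subst_atom \<sigma> (head R)))
       (map2 adorned_atom cs (map (subst_atom \<sigma>) as) @ map plain_atom (map (subst_atom \<sigma>) (edb_atoms P R)))"
    using assms(1) unfolding adorned_rule_def Let_def id_apply as_def by blast
  show thesis
  proof (rule that)
    show "resolvent P R cs (Rule (subst_atom \<sigma> (head R))
       (concat (map (\<lambda>\<rho>. map (subst_atom \<sigma>) (body \<rho>)) \<rho>s) @ map (subst_atom \<sigma>) (edb_atoms P R)))"
      unfolding resolvent_def using * as_def by blast
    fix p c assume "Adorned p c \<in> atom_pred ` set (body R')"
    then show "\<exists>i < length cs. p = atom_pred (idb_atoms P R ! i) \<and> c = cs ! i"
      using assms(2) by (auto simp: R' adorned_atom_def plain_atom_def in_set_zip as_def) blast
  qed (simp add: R' adorned_atom_def)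
qed

text \<open>Since no variable is shared, the separate firing valuations glue together with the
  values that \<nu> prescribes on \<open>R\<close>.\<close>

lemma fires_apart:
  assumes apart: "\<forall>i < length \<rho>s. vars_rule R \<inter> vars_rule (\<rho>s ! i) = {} \<and>
        (\<forall>j < i. vars_rule (\<rho>s ! j) \<inter> vars_rule (\<rho>s ! i) = {})"
    and fires: "\<And>i. i < length \<rho>s \<Longrightarrow> fires (\<rho>s ! i) I (f i)"
  shows "\<exists>\<mu>. (\<forall>x \<in> vars_rule R. \<mu> x = \<nu> x) \<and> (\<forall>i < length \<rho>s.
    ground_atom \<mu> (head (\<rho>s ! i)) = f i \<and> ground_atom \<mu> ` set (body (\<rho>s ! i)) \<subseteq> I)"
proof -
  obtain \<nu>s where \<nu>s: "\<And>i. i < length \<rho>s \<Longrightarrow> ground_atom (\<nu>s i) (head (\<rho>s ! i)) = f i \<and>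
      ground_atom (\<nu>s i) ` set (body (\<rho>s ! i)) \<subseteq> I"
    using fires unfolding fires_def by metis
  define \<mu> where "\<mu> x = (if x \<in> vars_rule R then \<nu> x
      else \<nu>s (THE i. i < length \<rho>s \<and> x \<in> vars_rule (\<rho>s ! i)) x)" for x
  have \<mu>: "\<mu> x = \<nu>s i x" if "i < length \<rho>s" "x \<in> vars_rule (\<rho>s ! i)" for i x
  proof -
    have "(THE i. i < length \<rho>s \<and> x \<in> vars_rule (\<rho>s ! i)) = i"
    proof (rule the_equality)
      fix j assume j: "j < length \<rho>s \<and> x \<in> vars_rule (\<rho>s ! j)"
      show "j = i"
        using apart that j by (cases i j rule: linorder_cases) blast+
    qed (use that in simp)
    moreover have "x \<notin> vars_rule R"
      using apart that by blast
    ultimately show ?thesis by (simp add: \<mu>_def)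
  qed
  have "ground_atom \<mu> a = ground_atom (\<nu>s i) a"
    if "i < length \<rho>s" "a \<in> insert (head (\<rho>s ! i)) (set (body (\<rho>s ! i)))" for i a
    by (rule ground_atom_cong, rule \<mu>[OF that(1)]) (use that in \<open>auto simp: vars_rule_def\<close>)
  then show ?thesis
    using \<nu>s by (intro exI[of _ \<mu>]) (auto simp: \<mu>_def image_subset_iff)
qed

lemma idb_atomsD:
  assumes "i < length (idb_atoms P R)"
  shows "idb_atoms P R ! i \<in> set (body R)" "atom_pred (idb_atoms P R ! i) \<in> idb P"
  using nth_mem[OF assms] by (auto simp: idb_atoms_def)

lemma ground_atom_agree:
  assumes "\<forall>x \<in> vars_rule R. \<mu> x = \<nu> x" "a \<in> insert (head R) (set (body R))"
  shows "ground_atom \<mu> a = ground_atom \<nu> a"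
  by (rule ground_atom_cong) (use assms in \<open>auto simp: vars_rule_def\<close>)

lemma fires_unifier:
  assumes \<mu>: "\<forall>x \<in> vars_rule R. \<mu> x = \<nu> x"
    and "\<And>i. i < length (idb_atoms P R) \<Longrightarrow>
      ground_atom \<mu> (head (\<rho>s ! i)) = ground_atom \<nu> (idb_atoms P R ! i)"
  shows "unifier (\<lambda>x. Const (\<mu> x))
    {(atom_args (idb_atoms P R ! i), atom_args (head (\<rho>s ! i))) | i. i < length (idb_atoms P R)}"
proof -
  have "ground_atom \<mu> (idb_atoms P R ! i) = ground_atom \<mu> (head (\<rho>s ! i))"
    if "i < length (idb_atoms P R)" for i
    using that assms(2) ground_atom_agree[OF \<mu>] idb_atomsD(1) by fastforce
  then have "map (ground_trm \<mu>) (atom_args (idb_atoms P R ! i)) = map (ground_trm \<mu>) (atom_args (head (\<rho>s ! i)))"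
    if "i < length (idb_atoms P R)" for i
    using that by (simp add: ground_atom_def)
  moreover have "map (subst_trm (\<lambda>x. Const (\<mu> x))) ts = map Const (map (ground_trm \<mu>) ts)" for ts :: "'b trm list"
    by (simp add: subst_trm_Const)
  ultimately show ?thesis
    unfolding unifier_def by (auto simp del: map_map map_eq_conv)
qed

text \<open>The lifting step of resolution: the glued valuation, read as a ground substitution,
  unifies subgoals with heads, so it factors through the most general unifier. The factor gives the
  valuation that fires the resolvent.\<close>

lemma resolvent_fires:
  assumes "resolvent P R cs \<rho>" and len: "length cs = length (idb_atoms P R)"
    and fires: "\<And>i \<rho>'. i < length cs \<Longrightarrow> \<rho>' \<in> cs ! i \<Longrightarrow> fires \<rho>' I (ground_atom \<nu> (idb_atoms P R ! i))"
    and edb: "\<And>a. a \<in> set (edb_atoms P R) \<Longrightarrow> ground_atom \<nu> a \<in> I"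
  shows "fires \<rho> I (ground_atom \<nu> (head R))"
proof -
  obtain \<rho>s \<sigma> where *: "length \<rho>s = length cs" "\<forall>i < length cs. \<rho>s ! i \<in> cs ! i"
     "\<forall>i < length \<rho>s. vars_rule R \<inter> vars_rule (\<rho>s ! i) = {} \<and>
        (\<forall>j < i. vars_rule (\<rho>s ! j) \<inter> vars_rule (\<rho>s ! i) = {})"
     and mgu: "mgu \<sigma> {(atom_args (idb_atoms P R ! i), atom_args (head (\<rho>s ! i))) | i. i < length (idb_atoms P R)}"
     and \<rho>: "\<rho> = Rule (subst_atom \<sigma> (head R))
       (concat (map (\<lambda>\<rho>. map (subst_atom \<sigma>) (body \<rho>)) \<rho>s) @ map (subst_atom \<sigma>) (edb_atoms P R))"
    using assms(1) unfolding resolvent_def by blast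
  have "fires (\<rho>s ! i) I (ground_atom \<nu> (idb_atoms P R ! i))" if "i < length \<rho>s" for i
    using that * fires by simp
  from fires_apart[OF *(3) this, of \<nu>] obtain \<mu> where \<mu>: "\<forall>x \<in> vars_rule R. \<mu> x = \<nu> x"
    "\<forall>i < length \<rho>s. ground_atom \<mu> (head (\<rho>s ! i)) = ground_atom \<nu> (idb_atoms P R ! i) \<and>
       ground_atom \<mu> ` set (body (\<rho>s ! i)) \<subseteq> I"
    by blast
  have "unifier (\<lambda>x. Const (\<mu> x)) {(atom_args (idb_atoms P R ! i), atom_args (head (\<rho>s ! i))) | i. i < length (idb_atoms P R)}"
    using fires_unifier[OF \<mu>(1)] \<mu>(2) *(1) len by simp
  then obtain \<delta> where \<delta>: "\<And>x. Const (\<mu> x) = subst_trm \<delta> (\<sigma> x)"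
    using mgu unfolding mgu_def by blast
  \<comment> \<open>\<delta> may be non-ground on some variables. Grounding with \<mu> is harmless,
    because \<delta> sends each \<open>\<sigma> x\<close> to a constant already.\<close>
  define \<kappa> where "\<kappa> x = ground_trm \<mu> (\<delta> x)" for x
  have "ground_trm \<kappa> (\<sigma> x) = \<mu> x" for x
  proof -
    have "ground_trm \<kappa> (\<sigma> x) = ground_trm \<mu> (subst_trm \<delta> (\<sigma> x))"
      by (simp add: ground_trm_subst \<kappa>_def[abs_def])
    also have "\<dots> = \<mu> x" by (simp flip: \<delta>)
    finally show ?thesis .
  qed
  then have \<kappa>: "ground_atom \<kappa> (subst_atom \<sigma> a) = ground_atom \<mu> a" for a :: "('a, 'b) atom"
    by (simp add: ground_atom_subst)
  have "ground_atom \<mu> a \<in> I" if "a \<in> set (edb_atoms P R)" for a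
    using edb[OF that] ground_atom_agree[OF \<mu>(1), of a] that by (simp add: edb_atoms_def)
  moreover have "ground_atom \<mu> a \<in> I" if "\<rho>' \<in> set \<rho>s" "a \<in> set (body \<rho>')" for \<rho>' a
    using \<mu>(2) that by (fastforce simp: in_set_conv_nth)
  ultimately have "ground_atom \<kappa> ` set (body \<rho>) \<subseteq> I"
    by (auto simp: \<rho> \<kappa>)
  moreover have "ground_atom \<kappa> (head \<rho>) = ground_atom \<nu> (head R)"
    using ground_atom_agree[OF \<mu>(1)] by (simp add: \<rho> \<kappa>)
  ultimately show ?thesis
    unfolding fires_def by blast
qed

text \<open>Adornments that fire on the ground subgoals provide a ground unifier, so
  \<open>process\<close> cannot skip such a choice.\<close>

lemma adorned_rule_exists:
  assumes len: "length cs = length (idb_atoms P R)"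
    and cs: "\<And>i. i < length cs \<Longrightarrow> \<exists>\<rho>. cs ! i = adornment \<rho>"
    and fires: "\<And>i \<rho>'. i < length cs \<Longrightarrow> \<rho>' \<in> cs ! i \<Longrightarrow> fires \<rho>' I (ground_atom \<nu> (idb_atoms P R ! i))"
  shows "\<exists>R'. adorned_rule id P R cs R'"
proof -
  obtain \<rho>f where \<rho>f: "\<And>i. i < length cs \<Longrightarrow> cs ! i = adornment (\<rho>f i)"
    using cs by metis
  obtain \<rho>s where \<rho>s: "length \<rho>s = length cs" "\<forall>i < length cs. variant (\<rho>f i) (\<rho>s ! i)"
    "\<forall>i < length \<rho>s. vars_rule R \<inter> vars_rule (\<rho>s ! i) = {} \<and>
       (\<forall>j < i. vars_rule (\<rho>s ! j) \<inter> vars_rule (\<rho>s ! i) = {})"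
    using variants_apart[of "vars_rule R" "map \<rho>f [0..<length cs]"] by auto
  have mem: "\<forall>i < length cs. \<rho>s ! i \<in> cs ! i"
    using \<rho>s \<rho>f by (simp add: adornment_def)
  have "fires (\<rho>s ! i) I (ground_atom \<nu> (idb_atoms P R ! i))" if "i < length \<rho>s" for i
    using that \<rho>s mem fires by simp
  from fires_apart[OF \<rho>s(3) this, of \<nu>] obtain \<mu> where \<mu>: "\<forall>x \<in> vars_rule R. \<mu> x = \<nu> x"
    "\<forall>i < length \<rho>s. ground_atom \<mu> (head (\<rho>s ! i)) = ground_atom \<nu> (idb_atoms P R ! i)"
    by blast
  have "unifier (\<lambda>x. Const (\<mu> x)) {(atom_args (idb_atoms P R ! i), atom_args (head (\<rho>s ! i))) | i. i < length (idb_atoms P R)}"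
    using fires_unifier[OF \<mu>(1)] \<mu>(2) \<rho>s(1) len by simp
  then obtain \<sigma> where "mgu \<sigma> {(atom_args (idb_atoms P R ! i), atom_args (head (\<rho>s ! i))) | i. i < length (idb_atoms P R)}"
    using mgu_exists[rotated] by fastforce
  then show ?thesis
    using \<rho>s mem unfolding adorned_rule_def Let_def by blast
qed

lemma choice_preds:
  assumes "choice P S R cs" "i < length cs"
  shows "Adorned (atom_pred (idb_atoms P R ! i)) (cs ! i) \<in> preds S"
proof -
  obtain T where "T \<in> S" "atom_pred (head T) = Adorned (atom_pred (idb_atoms P R ! i)) (cs ! i)"
    using assms by (auto simp: choice_def)
  then show ?thesis
    unfolding preds_def by (auto intro!: bexI[of _ T])
qed

text \<open>Soundness by pullback: a valuation that fires the resolvent is composed with \<sigma>.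
  Under it the subgoals of \<open>R\<close> coincide with the heads of the adornments, which
  therefore derive them, and then \<open>R\<close> derives its head. \<open>mgu_constants\<close>
  keeps the constants within those of the program.\<close>

lemma resolvent_expansion:
  assumes P: "datalog_program ar P" and S: "adorned_program ar P S" and ch: "choice P S R cs"
    and "resolvent P R cs \<rho>"
  shows "expansion ar P \<rho>"
proof -
  obtain \<rho>s \<sigma> where *: "length \<rho>s = length cs" "\<forall>i < length cs. \<rho>s ! i \<in> cs ! i"
     and mgu: "mgu \<sigma> {(atom_args (idb_atoms P R ! i), atom_args (head (\<rho>s ! i))) | i. i < length (idb_atoms P R)}"
     and \<rho>: "\<rho> = Rule (subst_atom \<sigma> (head R))
       (concat (map (\<lambda>\<rho>. map (subst_atom \<sigma>) (body \<rho>)) \<rho>s) @ map (subst_atom \<sigma>) (edb_atoms P R))"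
    using assms(4) unfolding resolvent_def by blast
  have R: "R \<in> P" and len: "length cs = length (idb_atoms P R)"
    using ch by (auto simp: choice_def)
  have atomR: "length (atom_args a) = ar (atom_pred a)" "set2_atom a \<subseteq> constants P"
    "atom_pred a \<in> preds P" if "a \<in> insert (head R) (set (body R))" for a
    using P R that by (auto simp: datalog_program_def constants_def preds_def)
  have exp: "expansion ar P (\<rho>s ! i)" "atom_pred (head (\<rho>s ! i)) = atom_pred (idb_atoms P R ! i)"
    if i: "i < length cs" for i
  proof -
    have "Adorned (atom_pred (idb_atoms P R ! i)) (cs ! i) \<in> preds S"
      using choice_preds[OF ch i] .
    then show "expansion ar P (\<rho>s ! i)" "atom_pred (head (\<rho>s ! i)) = atom_pred (idb_atoms P R ! i)"
      using adorned_classD[OF S] *(2) i by blast+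
  qed
  have \<sigma>: "set_trm (\<sigma> x) \<subseteq> constants P" for x
  proof (rule mgu_constants[OF mgu])
    fix s t u
    assume "(s, t) \<in> {(atom_args (idb_atoms P R ! i), atom_args (head (\<rho>s ! i))) | i. i < length (idb_atoms P R)}"
      and u: "u \<in> set s \<union> set t"
    then obtain i where i: "i < length cs" "s = atom_args (idb_atoms P R ! i)" "t = atom_args (head (\<rho>s ! i))"
      using len by auto
    have "set2_atom (idb_atoms P R ! i) \<subseteq> constants P" "set2_atom (head (\<rho>s ! i)) \<subseteq> constants P"
      using exp(1)[OF i(1)] atomR(2) idb_atomsD(1) i(1) len by (auto simp: expansion_def)
    then show "set_trm u \<subseteq> constants P"
      using u i(2,3) by (auto simp: set2_atom_alt)
  qed
  have body: "\<exists>b. a = subst_atom \<sigma> b \<and> length (atom_args b) = ar (atom_pred b) \<and>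
      set2_atom b \<subseteq> constants P \<and> atom_pred b \<in> edb P" if "a \<in> set (body \<rho>)" for a
  proof -
    from that consider i b where "i < length cs" "b \<in> set (body (\<rho>s ! i))" "a = subst_atom \<sigma> b"
      | b where "b \<in> set (edb_atoms P R)" "a = subst_atom \<sigma> b"
      using *(1) by (auto simp: \<rho> in_set_conv_nth[of _ \<rho>s])
    then show ?thesis
    proof cases
      case 1
      then show ?thesis
        using exp(1)[OF 1(1)] by (intro exI[of _ b]) (auto simp: expansion_def)
    next
      case 2
      then show ?thesis
        using atomR[of b] by (intro exI[of _ b]) (auto simp: edb_atoms_def edb_def)
    qed
  qed
  have headR: "head \<rho> = subst_atom \<sigma> (head R)"
    by (simp add: \<rho>)
  show ?thesis
    unfolding expansion_def
  proof (intro conjI impI allI ballI)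
    show "atom_pred (head \<rho>) \<in> preds P"
      using atomR(3) by (simp add: headR)
    show "atom_pred ` set (body \<rho>) \<subseteq> edb P"
      using body by fastforce
    fix a assume "a \<in> insert (head \<rho>) (set (body \<rho>))"
    then obtain b where "a = subst_atom \<sigma> b" "length (atom_args b) = ar (atom_pred b)"
      "set2_atom b \<subseteq> constants P"
      using body atomR headR by blast
    then show "length (atom_args a) = ar (atom_pred a)" "set2_atom a \<subseteq> constants P"
      using set2_atom_subst[where \<sigma> = \<sigma>, OF _ \<sigma>] by auto
  next
    assume "atom_pred (head \<rho>) \<in> edb P"
    \<comment> \<open>A nonempty body would put the head predicate into
      \<open>idb P\<close>.\<close>
    then have "body R = []"
      using R by (auto simp: headR edb_def idb_def)
    then show "body \<rho> = []"
      using *(1) len by (simp add: \<rho> idb_atoms_def edb_atoms_def)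
  next
    fix I f assume edb: "atom_pred (head \<rho>) \<notin> edb P" and "fires \<rho> I f"
    then obtain \<nu> where \<nu>: "ground_atom \<nu> (head \<rho>) = f" "ground_atom \<nu> ` set (body \<rho>) \<subseteq> I"
      by (auto simp: fires_def)
    define \<mu> where "\<mu> = (\<lambda>x. ground_trm \<nu> (\<sigma> x))"
    have \<mu>: "ground_atom \<nu> (subst_atom \<sigma> a) = ground_atom \<mu> a" for a :: "('a, 'b) atom"
      by (simp add: ground_atom_subst \<mu>_def)
    have "ground_atom \<mu> a \<in> least_interp (edb P) P I" if a: "a \<in> set (body R)" for a
    proof (cases "atom_pred a \<in> idb P")
      case False
      then have "subst_atom \<sigma> a \<in> set (body \<rho>)"
        using a by (simp add: \<rho> edb_atoms_def)
      then show ?thesis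
        using \<nu>(2) \<mu>[of a] by (intro least_interp.given) auto
    next
      case True
      then have "a \<in> set (idb_atoms P R)"
        using a by (simp add: idb_atoms_def)
      then obtain i where i: "i < length cs" "idb_atoms P R ! i = a"
        using len by (auto simp: in_set_conv_nth)
      have "map (subst_trm \<sigma>) (atom_args a) = map (subst_trm \<sigma>) (atom_args (head (\<rho>s ! i)))"
        using mgu i len by (fastforce simp: mgu_def unifier_def)
      then have "subst_atom \<sigma> a = subst_atom \<sigma> (head (\<rho>s ! i))"
        using exp(2)[OF i(1)] i(2) by (simp add: subst_atom_def)
      then have eq: "ground_atom \<mu> a = ground_atom \<mu> (head (\<rho>s ! i))"
        by (simp flip: \<mu>)
      have "subst_atom \<sigma> b \<in> set (body \<rho>)" if "b \<in> set (body (\<rho>s ! i))" for b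
        using that i(1) *(1) by (auto simp: \<rho>)
      then have "fires (\<rho>s ! i) I (ground_atom \<mu> a)"
        unfolding fires_def eq using \<nu>(2) \<mu> by (intro exI[of _ \<mu>]) (auto simp flip: \<mu>)
      moreover have "atom_pred (head (\<rho>s ! i)) \<notin> edb P"
        using exp(2)[OF i(1)] i(2) True by (simp add: edb_def)
      ultimately show ?thesis
        using exp(1)[OF i(1)] unfolding expansion_def by blast
    qed
    then show "f \<in> least_interp (edb P) P I"
      using least_interp.derived[OF R] edb \<nu>(1) \<mu> by (auto simp: headR)
  qed
qed

section \<open>Growth of the adorned program\<close>

lemma nonrecursive_insert:
  assumes "nonrecursive S" "atom_pred (head R) \<notin> preds S"
    "atom_pred (head R) \<notin> atom_pred ` set (body R)"
  shows "nonrecursive (insert R S)"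
proof -
  let ?h = "atom_pred (head R)"
  \<comment> \<open>The new head occurs neither in \<open>S\<close> nor in its own body, so no edge
    enters it. A path that starts elsewhere uses old edges only, and no cycle passes through the new
    head.\<close>
  have edge: "(a \<noteq> ?h \<longrightarrow> depends S a b) \<and> b \<noteq> ?h" if "depends (insert R S) a b" for a b
    using that assms(2,3) unfolding depends_def preds_def by blast
  have path: "b \<noteq> ?h \<and> (a \<noteq> ?h \<longrightarrow> (depends S)\<^sup>+\<^sup>+ a b)"
    if "(depends (insert R S))\<^sup>+\<^sup>+ a b" for a b
    using that
  proof induction
    case (base b)
    then show ?case using edge by blast
  next
    case (step b c)
    then show ?case using edge tranclp.trancl_into_trancl by metis
  qed
  then show ?thesis
    using assms(1) unfolding nonrecursive_def recursive_in_def by blast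
qed

lemma adorned_program_empty: "adorned_program ar P {}"
proof -
  have "\<not> (depends ({} :: ('a, 'b) arule set))\<^sup>+\<^sup>+ a b" for a b
  proof
    assume "(depends ({} :: ('a, 'b) arule set))\<^sup>+\<^sup>+ a b"
    then show False by induction (auto simp: depends_def)
  qed
  then show ?thesis
    by (auto simp: adorned_program_def nonrecursive_def recursive_in_def preds_def)
qed

lemma adorned_program_insert:
  assumes P: "datalog_program ar P" and S: "adorned_program ar P S" and ch: "choice P S R cs"
    and R': "adorned_rule id P R cs R'"
  obtains \<rho> where "resolvent P R cs \<rho>" "expansion ar P \<rho>" "h_cont R' S \<longleftrightarrow> covered S \<rho>"
    "covered (insert R' S) \<rho>" "\<not> h_cont R' S \<longrightarrow> adorned_program ar P (insert R' S)"
proof -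
  have "length cs = length (idb_atoms P R)"
    using ch by (simp add: choice_def)
  from adorned_ruleE[OF R' this] obtain \<rho> where \<rho>: "resolvent P R cs \<rho>"
    "atom_pred (head R') = Adorned (atom_pred (head \<rho>)) (adornment \<rho>)"
    "\<And>p c. Adorned p c \<in> atom_pred ` set (body R') \<Longrightarrow>
       \<exists>i < length cs. p = atom_pred (idb_atoms P R ! i) \<and> c = cs ! i"
    by blast
  note exp = resolvent_expansion[OF P S ch \<rho>(1)]
  note iff = h_cont_iff_covered[OF S \<rho>(2)]
  have mem: "\<rho> \<in> adornment \<rho>"
    by (simp add: adornment_def variant_refl)
  have body: "Adorned p c \<in> preds S" if "Adorned p c \<in> atom_pred ` set (body R')" for p c
    using \<rho>(3)[OF that] choice_preds[OF ch] by blast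
  have preds: "preds (insert R' S) = insert (atom_pred (head R')) (atom_pred ` set (body R')) \<union> preds S"
    by (auto simp: preds_def)
  have "\<rho> \<in> derived_rules (insert R' S)"
    using mem \<rho>(2) by (auto simp: derived_rules_def preds)
  then have cov: "covered (insert R' S) \<rho>"
    using subsumes_refl by (auto simp: covered_def)
  have ins: "adorned_program ar P (insert R' S)" if "\<not> h_cont R' S"
  proof -
    \<comment> \<open>Otherwise the class of \<rho> is already present, and \<rho> as its member
      covers itself.\<close>
    have new: "atom_pred (head R') \<notin> preds S"
      using that iff mem subsumes_refl unfolding covered_def derived_rules_def \<rho>(2) by blast
    then have "nonrecursive (insert R' S)"
      using S body \<rho>(2) by (intro nonrecursive_insert) (auto simp: adorned_program_def)
    moreover have "(\<exists>\<rho>. atom_pred (head \<rho>) = q \<and> c = adornment \<rho> \<and> expansion ar P \<rho>) \<and>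
        (\<exists>T \<in> insert R' S. atom_pred (head T) = Adorned q c)"
      if "Adorned q c \<in> preds (insert R' S)" for q c
    proof (cases "Adorned q c \<in> preds S")
      case True
      then show ?thesis using S by (auto simp: adorned_program_def)
    next
      case False
      then have "Adorned q c = atom_pred (head R')"
        using that preds body by auto
      then show ?thesis using \<rho>(2) exp by auto
    qed
    ultimately show ?thesis
      using S by (simp add: adorned_program_def)
  qed
  show thesis
    by (rule that[OF \<rho>(1) exp iff cov]) (use ins in blast)
qed

text \<open>Whether the adorned rule is inserted or rejected, its resolvent is covered afterwards.
  Completeness builds on this.\<close>

lemma process_cases:
  assumes P: "datalog_program ar P" and S: "adorned_program ar P S" and ch: "choice P S R cs"
    and pr: "process id h_cont P R cs S S'"
  obtains (idle) "S' = S" "\<nexists>R'. adorned_rule id P R cs R'"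
    | (resolve) \<rho> where "resolvent P R cs \<rho>" "expansion ar P \<rho>" "covered S' \<rho>" "S \<subseteq> S'"
      "S' = S \<or> \<not> covered S \<rho>" "adorned_program ar P S'"
proof -
  from pr consider "S' = S" "\<nexists>R'. adorned_rule id P R cs R'"
    | R' where "adorned_rule id P R cs R'" "S' = (if h_cont R' S then S else insert R' S)"
    by (auto simp: process_def)
  then show thesis
  proof cases
    case 1
    then show thesis by (rule idle)
  next
    case 2
    from adorned_program_insert[OF P S ch 2(1)] obtain \<rho> where
      "resolvent P R cs \<rho>" "expansion ar P \<rho>" "h_cont R' S \<longleftrightarrow> covered S \<rho>"
      "covered (insert R' S) \<rho>" "\<not> h_cont R' S \<longrightarrow> adorned_program ar P (insert R' S)" .
    then show thesis
      using 2(2) S by (intro resolve[of \<rho>]) auto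
  qed
qed


section \<open>Runs of the algorithm\<close>

lemma run_step:
  assumes "adornment_run id h_cont P r"
  obtains "r (Suc n) = r n" | R cs where "choice P (r n) R cs" "process id h_cont P R cs (r n) (r (Suc n))"
  using assms unfolding adornment_run_def by blast

lemma run_adorned:
  assumes P: "datalog_program ar P" and run: "adornment_run id h_cont P r"
  shows "adorned_program ar P (r n)"
proof (induction n)
  case 0
  then show ?case
    using run adorned_program_empty by (simp add: adornment_run_def)
next
  case (Suc n)
  from run show ?case
  proof (cases rule: run_step[where n = n])
    case 1
    then show ?thesis using Suc by simp
  next
    case (2 R cs)
    show ?thesis
      by (rule process_cases[OF P Suc 2]) (use Suc in auto)
  qed
qed

lemma run_mono:
  assumes P: "datalog_program ar P" and run: "adornment_run id h_cont P r" and "m \<le> n"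
  shows "r m \<subseteq> r n"
proof (rule lift_Suc_mono_le[OF _ \<open>m \<le> n\<close>])
  fix n
  from run show "r n \<subseteq> r (Suc n)"
  proof (cases rule: run_step[where n = n])
    case 1
    then show ?thesis by simp
  next
    case (2 R cs)
    show ?thesis
      by (rule process_cases[OF P run_adorned[OF P run] 2]) auto
  qed
qed

lemma choice_mono: "choice P S R cs \<Longrightarrow> S \<subseteq> T \<Longrightarrow> choice P T R cs"
  unfolding choice_def by blast

section \<open>Completeness of fair runs\<close>

lemma least_interp_edb: "f \<in> least_interp E P I \<Longrightarrow> fst f \<in> E \<Longrightarrow> f \<in> I"
  by (cases rule: least_interp.cases) auto

lemma least_interp_mono: "f \<in> least_interp E P I \<Longrightarrow> I \<subseteq> J \<Longrightarrow> f \<in> least_interp E P J"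
  by (induction rule: least_interp.induct) (auto intro: least_interp.intros)

text \<open>Induction on the derivation. Each subgoal is fired by an adornment of some stage; at a
  common later stage these form an available choice, which fairness eventually processes. The
  resolvent fires by lifting, and so does whatever adornment covers it, even if the resolvent itself
  was rejected.\<close>

lemma run_complete:
  assumes P: "datalog_program ar P" and run: "adornment_run id h_cont P r"
    and I: "\<And>f. f \<in> I \<Longrightarrow> fst f \<in> edb P"
    and "f \<in> least_interp (edb P) P I" "fst f \<notin> edb P"
  shows "\<exists>n. \<exists>\<rho> \<in> derived_rules (r n). fires \<rho> I f"
  using assms(4,5)
proof (induction rule: least_interp.induct)
  case (given f)
  then show ?case using I by blast
next
  case (derived R \<nu>)
  note S = run_adorned[OF P run]
  define as where "as = idb_atoms P R"
  have "\<exists>n. \<exists>\<rho> \<in> derived_rules (r n). fires \<rho> I (ground_atom \<nu> a)" if "a \<in> set as" for a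
    using derived.IH[of a] that by (auto simp: as_def idb_atoms_def edb_def)
  then obtain nf where nf: "\<And>a. a \<in> set as \<Longrightarrow>
      \<exists>\<rho> \<in> derived_rules (r (nf a)). fires \<rho> I (ground_atom \<nu> a)"
    by metis
  \<comment> \<open>The sum is a common upper bound of the finitely many stages.\<close>
  define n where "n = (\<Sum>a \<in> set as. nf a)"
  have "\<exists>c. Adorned (atom_pred a) c \<in> preds (r n) \<and> (\<forall>\<rho>' \<in> c. fires \<rho>' I (ground_atom \<nu> a))"
    if a: "a \<in> set as" for a
  proof -
    have "nf a \<le> n"
      unfolding n_def by (rule member_le_sum) (use a in auto)
    then have "preds (r (nf a)) \<subseteq> preds (r n)"
      by (intro preds_mono run_mono[OF P run])
    then obtain q c \<rho> where c: "Adorned q c \<in> preds (r n)" "\<rho> \<in> c" "fires \<rho> I (ground_atom \<nu> a)"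
      using nf[OF a] by (auto simp: derived_rules_def)
    have "q = atom_pred (head \<rho>)"
      using adorned_classD(2)[OF S c(1,2)] by simp
    also have "\<dots> = atom_pred a"
      using c(3) fst_ground_atom unfolding fires_def by metis
    finally show ?thesis
      using c fires_subsumes[OF adorned_class_subsumes[OF S c(1) _ c(2)]] by blast
  qed
  then obtain cf where cf: "\<And>a. a \<in> set as \<Longrightarrow> Adorned (atom_pred a) (cf a) \<in> preds (r n)"
    "\<And>a \<rho>'. a \<in> set as \<Longrightarrow> \<rho>' \<in> cf a \<Longrightarrow> fires \<rho>' I (ground_atom \<nu> a)"
    by metis
  define cs where "cs = map cf as"
  have len: "length cs = length (idb_atoms P R)"
    by (simp add: cs_def as_def)
  have heads: "(\<exists>\<rho>. c = adornment \<rho>) \<and> (\<exists>T \<in> r n. atom_pred (head T) = Adorned q c)"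
    if "Adorned q c \<in> preds (r n)" for q c
    using S[of n] that by (auto simp: adorned_program_def)
  have "choice P (r n) R cs"
    using derived.hyps(1) cf(1) heads by (auto simp: choice_def cs_def as_def)
  then obtain m where m: "m \<ge> n" "process id h_cont P R cs (r m) (r (Suc m))" "choice P (r m) R cs"
    using run choice_mono[OF _ run_mono[OF P run]] unfolding adornment_run_def by blast
  have fires: "fires \<rho>' I (ground_atom \<nu> (idb_atoms P R ! i))" if "i < length cs" "\<rho>' \<in> cs ! i" for i \<rho>'
    using cf(2) that by (auto simp: cs_def as_def)
  have "\<exists>R'. adorned_rule id P R cs R'"
  proof (rule adorned_rule_exists[OF len _ fires])
    fix i assume "i < length cs"
    then have "Adorned (atom_pred (as ! i)) (cs ! i) \<in> preds (r n)"
      using cf(1) by (simp add: cs_def)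
    then show "\<exists>\<rho>. cs ! i = adornment \<rho>"
      using heads by blast
  qed
  then obtain \<rho> where \<rho>: "resolvent P R cs \<rho>" "covered (r (Suc m)) \<rho>"
    using process_cases[OF P S m(3,2)] by blast
  have "ground_atom \<nu> a \<in> I" if "a \<in> set (edb_atoms P R)" for a
  proof -
    have "a \<in> set (body R)" "atom_pred a \<in> edb P"
      using that derived.hyps(1) by (auto simp: edb_atoms_def edb_def preds_def)
    then show ?thesis
      using derived.hyps(3) least_interp_edb by fastforce
  qed
  with \<rho>(1) len fires have "fires \<rho> I (ground_atom \<nu> (head R))"
    by (rule resolvent_fires)
  then show ?case
    using \<rho>(2) fires_subsumes unfolding covered_def by blast
qed

lemma finite_preds: "datalog_program ar P \<Longrightarrow> finite (preds P)"
  by (auto simp: preds_def datalog_program_def)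

section \<open>From termination to an equivalent nonrecursive program\<close>

lemma terminates_imp_bounded:
  fixes P :: "('p, 'c) rule set"
  assumes P: "datalog_program ar P" and run: "adornment_run id h_cont P r" and "terminates r"
  shows "bounded_program ar P"
proof -
  obtain N where N: "\<And>n. n \<ge> N \<Longrightarrow> r n = r N"
    using assms(3) by (auto simp: terminates_def)
  note S = run_adorned[OF P run, of N]
  define rep where "rep a = (case a of Adorned q c \<Rightarrow> SOME \<rho>. \<rho> \<in> c)" for a :: "('p, 'c) apred"
  \<comment> \<open>A class may be infinite, so \<open>Q\<close> takes one representative of each.
    Members of a class subsume each other and hence fire alike.\<close>
  define Q where "Q = {rep (Adorned q c) | q c. Adorned q c \<in> preds (r N) \<and> q \<in> idb P}"
  have rep: "rep (Adorned q c) \<in> c" if "Adorned q c \<in> preds (r N)" for q c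
  proof -
    have "\<exists>\<rho>. \<rho> \<in> c"
      using S that variant_refl by (fastforce simp: adorned_program_def adornment_def)
    then show ?thesis by (simp add: rep_def) (rule someI_ex)
  qed
  have "finite (preds (r N))"
    using S by (auto simp: preds_def adorned_program_def)
  moreover have "Q \<subseteq> rep ` preds (r N)"
    by (auto simp: Q_def)
  ultimately have fin: "finite Q"
    by (meson finite_imageI finite_subset)
  have Q: "expansion ar P \<rho> \<and> atom_pred (head \<rho>) \<in> idb P" if "\<rho> \<in> Q" for \<rho>
    using that adorned_classD[OF S _ rep] by (auto simp: Q_def)
  have "datalog_program ar Q"
    using fin Q by (auto simp: datalog_program_def expansion_def)
  moreover have "nonrecursive Q"
  proof -
    have edge: "a \<in> idb P \<and> b \<in> edb P" if "depends Q a b" for a b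
      using that Q by (force simp: depends_def expansion_def)
    \<comment> \<open>Edges lead from IDB to EDB predicates, so no edge can follow another and every
      path has length one.\<close>
    have "a \<in> idb P \<and> b \<in> edb P" if "(depends Q)\<^sup>+\<^sup>+ a b" for a b
      using that by induction (use edge in \<open>auto simp: edb_def\<close>)
    then show ?thesis
      by (auto simp: nonrecursive_def recursive_in_def edb_def)
  qed
  moreover have "equivalent_to ar P Q"
    unfolding equivalent_to_def
  proof (intro allI impI ballI)
    fix I :: "('p \<times> 'c list) set" and q cs
    assume I: "instance_over ar (edb P) I" and q: "q \<in> idb P"
    show "(q, cs) \<in> least_interp (edb P) P I \<longleftrightarrow> (q, cs) \<in> least_interp (edb P) Q I"
    proof
      assume f: "(q, cs) \<in> least_interp (edb P) P I"
      have "fst f \<in> edb P" if "f \<in> I" for f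
        using I that by (auto simp: instance_over_def)
      then obtain n \<rho> where "\<rho> \<in> derived_rules (r n)" "fires \<rho> I (q, cs)"
        using run_complete[OF P run _ f] q by (auto simp: edb_def)
      moreover have "r n \<subseteq> r N"
        using run_mono[OF P run, of n "max n N"] N[of "max n N"] by simp
      ultimately obtain q' c where c: "Adorned q' c \<in> preds (r N)" "\<rho> \<in> c"
        using derived_rules_mono unfolding derived_rules_def by blast
      have "q' = q"
        using adorned_classD(2)[OF S c] \<open>fires \<rho> I (q, cs)\<close> fst_ground_atom
        unfolding fires_def by (metis fst_conv)
      moreover have "fires (rep (Adorned q' c)) I (q, cs)"
        using \<open>fires \<rho> I (q, cs)\<close> fires_subsumes adorned_class_subsumes[OF S c(1) rep[OF c(1)] c(2)]
        by blast
      ultimately obtain \<rho>' \<nu> where \<rho>': "\<rho>' \<in> Q" "ground_atom \<nu> (head \<rho>') = (q, cs)"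
        "ground_atom \<nu> ` set (body \<rho>') \<subseteq> I"
        using c(1) q unfolding Q_def fires_def by blast
      have "ground_atom \<nu> (head \<rho>') \<in> least_interp (edb P) Q I"
      proof (rule least_interp.derived[OF \<rho>'(1)])
        show "atom_pred (head \<rho>') \<notin> edb P"
          using Q[OF \<rho>'(1)] by (simp add: edb_def)
      qed (use \<rho>'(3) in \<open>blast intro: least_interp.given\<close>)
      then show "(q, cs) \<in> least_interp (edb P) Q I"
        by (simp only: \<rho>'(2))
    next
      assume "(q, cs) \<in> least_interp (edb P) Q I"
      then show "(q, cs) \<in> least_interp (edb P) P I"
      proof (cases rule: least_interp.cases)
        case given
        then show ?thesis by (rule least_interp.given)
      next
        case (derived \<rho> \<nu>)
        have "ground_atom \<nu> a \<in> I" if a: "a \<in> set (body \<rho>)" for a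
        proof -
          have "atom_pred a \<in> edb P"
            using Q[OF derived(2)] a unfolding expansion_def by blast
          then show ?thesis
            using least_interp_edb[OF derived(4)[OF a]] by simp
        qed
        then have "fires \<rho> I (q, cs)"
          unfolding fires_def derived(1) by blast
        then show ?thesis
          using Q[OF derived(2)] derived(3) unfolding expansion_def by blast
      qed
    qed
  qed
  ultimately show ?thesis
    unfolding bounded_program_def by blast
qed

section \<open>Bounded programs\<close>

text \<open>Derivations in a nonrecursive program have bounded depth and branching, hence boundedly
  many leaves. Well-founded induction along the dependencies gives a bound for each predicate that
  is uniform in the instance and the fact.\<close>

lemma nonrecursive_support:
  assumes "finite Q" "nonrecursive Q"
  shows "\<exists>k. \<forall>I cs. (p, cs) \<in> least_interp E Q I \<longrightarrow>
    (\<exists>J \<subseteq> I. finite J \<and> card J \<le> k \<and> (p, cs) \<in> least_interp E Q J)"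
proof -
  define rel where "rel = {(b, a). depends Q a b}"
  have "rel \<subseteq> preds Q \<times> preds Q"
    by (auto simp: rel_def depends_def preds_def)
  moreover have "finite (preds Q)"
    using assms(1) by (auto simp: preds_def)
  ultimately have "finite rel"
    by (meson finite_SigmaI finite_subset)
  moreover have "acyclic (rel\<inverse>)"
    using assms(2)
    by (auto simp: acyclic_def rel_def nonrecursive_def recursive_in_def converse_unfold trancl_def)
  ultimately have "wf rel"
    by (simp add: finite_acyclic_wf)
  then show ?thesis
  proof (induction p)
    case (less p)
    define D where "D = {p'. depends Q p p'}"
    have "D \<subseteq> preds Q"
      by (auto simp: D_def depends_def preds_def)
    then have finD: "finite D"
      using \<open>finite (preds Q)\<close> finite_subset by blast
    obtain kf where kf: "\<And>p' I cs. p' \<in> D \<Longrightarrow> (p', cs) \<in> least_interp E Q I \<Longrightarrow>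
        \<exists>J \<subseteq> I. finite J \<and> card J \<le> kf p' \<and> (p', cs) \<in> least_interp E Q J"
      using less unfolding D_def rel_def mem_Collect_eq case_prod_conv by metis
    \<comment> \<open>Sums serve as crude maxima: \<open>K\<close> bounds the support for every
      predicate that \<open>p\<close> depends on directly, \<open>L\<close> every body length. The
      summand 1 below pays for a fact taken from \<open>I\<close> itself.\<close>
    define K where "K = (\<Sum>p' \<in> D. kf p')"
    define L where "L = (\<Sum>R \<in> Q. length (body R))"
    have "\<exists>J \<subseteq> I. finite J \<and> card J \<le> 1 + L * K \<and> (p, cs) \<in> least_interp E Q J"
      if "(p, cs) \<in> least_interp E Q I" for I cs
      using that
    proof (cases rule: least_interp.cases)
      case given
      then show ?thesis
        by (intro exI[of _ "{(p, cs)}"]) (auto intro: least_interp.given)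
    next
      case (derived R \<nu>)
      have "\<exists>J \<subseteq> I. finite J \<and> card J \<le> K \<and> ground_atom \<nu> a \<in> least_interp E Q J"
        if a: "a \<in> set (body R)" for a
      proof -
        have "p = atom_pred (head R)"
          using derived(1) fst_ground_atom by (metis fst_conv)
        then have D: "atom_pred a \<in> D"
          using derived(2) a by (auto simp: D_def depends_def)
        then have "kf (atom_pred a) \<le> K"
          unfolding K_def by (intro member_le_sum finD) auto
        with kf[OF D] derived(4)[OF a] show ?thesis
          unfolding ground_atom_def by (meson order_trans)
      qed
      then obtain Jf where Jf: "\<And>a. a \<in> set (body R) \<Longrightarrow>
          Jf a \<subseteq> I \<and> finite (Jf a) \<and> card (Jf a) \<le> K \<and> ground_atom \<nu> a \<in> least_interp E Q (Jf a)"
        by metis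
      let ?J = "\<Union>a \<in> set (body R). Jf a"
      have "card ?J \<le> (\<Sum>a \<in> set (body R). card (Jf a))"
        by (rule card_UN_le) simp
      also have "\<dots> \<le> (\<Sum>a \<in> set (body R). K)"
        by (rule sum_mono) (use Jf in blast)
      also have "\<dots> = card (set (body R)) * K"
        by simp
      also have "\<dots> \<le> L * K"
      proof (rule mult_right_mono)
        have "length (body R) \<le> L"
          unfolding L_def by (rule member_le_sum) (use derived(2) assms(1) in auto)
        then show "card (set (body R)) \<le> L"
          using card_length order_trans by blast
      qed simp
      finally have "card ?J \<le> 1 + L * K" by simp
      moreover have "(p, cs) \<in> least_interp E Q ?J"
        unfolding derived(1)
        by (rule least_interp.derived[OF derived(2,3)])
          (use Jf in \<open>blast intro: least_interp_mono\<close>)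
      ultimately show ?thesis
        using Jf by (intro exI[of _ ?J]) auto
    qed
    then show ?case by blast
  qed
qed

section \<open>Freezing variables to fresh constants\<close>

lemma subst_atom_unfreeze:
  assumes \<nu>: "inj \<nu>" "range \<nu> \<inter> C = {}"
    and "set2_atom a \<subseteq> C" "set2_atom b \<subseteq> C" "ground_atom \<mu> a = ground_atom \<nu> b"
  shows "subst_atom (\<lambda>x. if \<mu> x \<in> range \<nu> then Var (inv \<nu> (\<mu> x)) else Const (\<mu> x)) a = b"
proof -
  define u where "u c = (if c \<in> range \<nu> then Var (inv \<nu> c) else Const c)" for c
  have unfreeze: "u (ground_trm \<nu> t) = t" if "set_trm t \<subseteq> C" for t
    using that \<nu> by (cases t) (auto simp: u_def)
  have "subst_trm (\<lambda>x. u (\<mu> x)) t = u (ground_trm \<mu> t)" if "set_trm t \<subseteq> C" for t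
    using that \<nu>(2) by (cases t) (auto simp: u_def)
  then have "map (subst_trm (\<lambda>x. u (\<mu> x))) (atom_args a) = map u (map (ground_trm \<mu>) (atom_args a))"
    using assms(3) by (auto simp: set2_atom_alt)
  also have "map (ground_trm \<mu>) (atom_args a) = map (ground_trm \<nu>) (atom_args b)"
    using assms(5) by (simp add: ground_atom_def)
  also have "map u (map (ground_trm \<nu>) (atom_args b)) = atom_args b"
    using assms(4) unfreeze by (simp add: set2_atom_alt SUP_le_iff map_idI)
  finally show ?thesis
    using assms(5) by (cases b) (simp add: subst_atom_def ground_atom_def u_def)
qed

lemma finite_constants: "datalog_program ar P \<Longrightarrow> finite (constants P)"
proof -
  have "finite (set_trm t)" for t :: "'a trm" by (cases t) auto
  then show "datalog_program ar P \<Longrightarrow> finite (constants P)"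
    by (auto simp: constants_def datalog_program_def set2_atom_alt)
qed

text \<open>The body of \<open>\<rho>\<close>, with its variables frozen to fresh constants, is an instance on which the
  equivalent nonrecursive program derives the frozen head from at most \<open>k\<close> facts.\<close>

lemma covered_small_subrule:
  fixes P :: "('p, 'c) rule set"
  assumes inf: "infinite (UNIV :: 'c set)"
    and P: "datalog_program ar P" and run: "adornment_run id h_cont P r"
    and eq: "equivalent_to ar P Q"
    and k: "\<And>I cs. (atom_pred (head \<rho>), cs) \<in> least_interp (edb P) Q I \<Longrightarrow>
      \<exists>J \<subseteq> I. finite J \<and> card J \<le> k \<and> (atom_pred (head \<rho>), cs) \<in> least_interp (edb P) Q J"
    and \<rho>: "expansion ar P \<rho>" "atom_pred (head \<rho>) \<notin> edb P"
  shows "\<exists>bs n. set bs \<subseteq> set (body \<rho>) \<and> length bs \<le> k \<and> covered (r n) (Rule (head \<rho>) bs)"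
proof -
  have "infinite (UNIV - constants P)"
    using inf finite_constants[OF P] by (simp add: Diff_infinite_finite)
  then obtain \<nu> :: "nat \<Rightarrow> 'c" where \<nu>: "inj \<nu>" "range \<nu> \<inter> constants P = {}"
    using infinite_countable_subset[of "UNIV - constants P"] by blast
  define q where "q = atom_pred (head \<rho>)"
  obtain cs where cs: "ground_atom \<nu> (head \<rho>) = (q, cs)"
    by (simp add: ground_atom_def q_def)
  have idb: "q \<in> idb P" "q \<notin> edb P"
    using \<rho> by (auto simp: expansion_def edb_def q_def)
  have inst: "instance_over ar (edb P) J" if "J \<subseteq> ground_atom \<nu> ` set (body \<rho>)" for J
    unfolding instance_over_def
  proof
    show "finite J"
      using that finite_subset by blast
    show "\<forall>(p, cs) \<in> J. p \<in> edb P \<and> length cs = ar p"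
      using that \<rho>(1) by (fastforce simp: expansion_def ground_atom_def)
  qed
  let ?I = "ground_atom \<nu> ` set (body \<rho>)"
  have "fires \<rho> ?I (q, cs)"
    using cs by (auto simp: fires_def)
  then have "(q, cs) \<in> least_interp (edb P) P ?I"
    using \<rho> by (auto simp: expansion_def)
  \<comment> \<open>Over to \<open>Q\<close>, for which the facts in \<open>J\<close> suffice, and
    back to \<open>P\<close>, for which the run is complete. \<open>J\<close> is again an instance
    over the EDB predicates, as equivalence demands.\<close>
  then have "(q, cs) \<in> least_interp (edb P) Q ?I"
    using eq idb(1) inst[of ?I] by (auto simp: equivalent_to_def)
  then obtain J where J: "J \<subseteq> ?I" "card J \<le> k" "(q, cs) \<in> least_interp (edb P) Q J"
    using k unfolding q_def by blast
  then have "(q, cs) \<in> least_interp (edb P) P J"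
    using eq idb(1) inst[of J] by (auto simp: equivalent_to_def)
  moreover have "fst f \<in> edb P" if "f \<in> J" for f
    using inst[OF J(1)] that by (auto simp: instance_over_def)
  ultimately obtain n \<rho>' where \<rho>': "\<rho>' \<in> derived_rules (r n)" "fires \<rho>' J (q, cs)"
    using run_complete[OF P run, of J "(q, cs)"] idb(2) by auto
  then obtain \<mu> where \<mu>: "ground_atom \<mu> (head \<rho>') = ground_atom \<nu> (head \<rho>)"
    "ground_atom \<mu> ` set (body \<rho>') \<subseteq> J"
    using cs by (auto simp: fires_def)
  \<comment> \<open>One body atom for each fact of \<open>J\<close>, so that the subrule has at most
    \<open>k\<close> atoms.\<close>
  obtain B where B: "B \<subseteq> set (body \<rho>)" "inj_on (ground_atom \<nu>) B" "J = ground_atom \<nu> ` B"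
    using J(1) by (auto simp: subset_image_inj)
  then have "finite B" "card B \<le> k"
    using J(2) finite_subset by (auto simp: card_image)
  then obtain bs where bs: "set bs = B" "length bs \<le> k"
    using finite_distinct_list distinct_card by metis
  define \<theta> where "\<theta> = (\<lambda>x. if \<mu> x \<in> range \<nu> then Var (inv \<nu> (\<mu> x)) else Const (\<mu> x))"
  have in_constants: "set2_atom a \<subseteq> constants P"
    if "expansion ar P \<rho>1" "a \<in> insert (head \<rho>1) (set (body \<rho>1))" for \<rho>1 a
    using that unfolding expansion_def by blast
  note exp' = derived_expansion[OF run_adorned[OF P run] \<rho>'(1)]
  have "subst_atom \<theta> (head \<rho>') = head \<rho>"
    unfolding \<theta>_def by (rule subst_atom_unfreeze[OF \<nu> _ _ \<mu>(1)])
      (use in_constants[OF exp'] in_constants[OF \<rho>(1)] in blast)+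
  moreover have "subst_atom \<theta> a \<in> set bs" if a: "a \<in> set (body \<rho>')" for a
  proof -
    obtain b where b: "b \<in> B" "ground_atom \<mu> a = ground_atom \<nu> b"
      using \<mu>(2) a B(3) by blast
    have "subst_atom \<theta> a = b"
      unfolding \<theta>_def
      by (rule subst_atom_unfreeze[OF \<nu> _ _ b(2)])
        (use a b(1) B(1) in_constants[OF exp'] in_constants[OF \<rho>(1)] in blast)+
    then show ?thesis using b(1) bs(1) by simp
  qed
  ultimately have "subsumes \<rho>' (Rule (head \<rho>) bs)"
    unfolding subsumes_def by (intro exI[of _ \<theta>]) auto
  then show ?thesis
    using \<rho>'(1) B(1) bs unfolding covered_def by blast
qed

section \<open>Finitely many short rules up to renaming\<close>

lemma finite_rules:
  fixes L :: nat
  assumes "finite X" "finite T"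
  defines "A \<equiv> {a. atom_pred a \<in> X \<and> set (atom_args a) \<subseteq> T \<and> length (atom_args a) \<le> L}"
  shows "finite {R. head R \<in> A \<and> set (body R) \<subseteq> A \<and> length (body R) \<le> k}"
proof -
  have "A \<subseteq> case_prod Atom ` (X \<times> {ts. set ts \<subseteq> T \<and> length ts \<le> L})"
  proof
    fix a assume "a \<in> A"
    then show "a \<in> case_prod Atom ` (X \<times> {ts. set ts \<subseteq> T \<and> length ts \<le> L})"
      by (cases a) (auto simp: A_def)
  qed
  then have "finite A"
    by (rule finite_subset) (intro finite_imageI finite_SigmaI assms finite_lists_length_le)
  have "{R. head R \<in> A \<and> set (body R) \<subseteq> A \<and> length (body R) \<le> k} \<subseteq>
      case_prod Rule ` (A \<times> {bs. set bs \<subseteq> A \<and> length bs \<le> k})"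
  proof
    fix R assume "R \<in> {R. head R \<in> A \<and> set (body R) \<subseteq> A \<and> length (body R) \<le> k}"
    then show "R \<in> case_prod Rule ` (A \<times> {bs. set bs \<subseteq> A \<and> length bs \<le> k})"
      by (cases R) auto
  qed
  then show ?thesis
    by (rule finite_subset)
      (intro finite_imageI finite_SigmaI \<open>finite A\<close> finite_lists_length_le)
qed

text \<open>No bijection of all naturals is built, as \<open>variant\<close> would require.
  Injectivity on the variables of \<open>R\<close> gives mutual subsumption, which transfers
  \<open>covered\<close> in both directions.\<close>

lemma rename_into:
  assumes "card (vars_rule R) \<le> M"
  shows "\<exists>S. subsumes R S \<and> subsumes S R \<and> vars_rule S \<subseteq> {..<M} \<and> length (body S) = length (body R) \<and>
    (\<exists>\<pi>. head S = subst_atom (Var \<circ> \<pi>) (head R) \<and> set (body S) = subst_atom (Var \<circ> \<pi>) ` set (body R))"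
proof -
  obtain \<pi> where \<pi>: "\<pi> ` vars_rule R \<subseteq> {..<M}" "inj_on \<pi> (vars_rule R)"
    using card_le_inj[of "vars_rule R" "{..<M}"] assms by auto
  let ?S = "Rule (subst_atom (Var \<circ> \<pi>) (head R)) (map (subst_atom (Var \<circ> \<pi>)) (body R))"
  have "subsumes R ?S"
    by (auto simp: subsumes_def)
  moreover have undo: "subst_atom (Var \<circ> inv_into (vars_rule R) \<pi>) (subst_atom (Var \<circ> \<pi>) a) = a"
    if "a \<in> insert (head R) (set (body R))" for a
  proof -
    have "vars_atom a \<subseteq> vars_rule R"
      using that by (auto simp: vars_rule_def)
    then have "subst_atom (Var \<circ> inv_into (vars_rule R) \<pi>) (subst_atom (Var \<circ> \<pi>) a) = subst_atom Var a"
      unfolding subst_atom_subst using \<pi>(2) by (intro subst_atom_cong) (auto simp: subset_iff)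
    then show ?thesis by simp
  qed
  have "subsumes ?S R"
    unfolding subsumes_def
    by (intro exI[of _ "Var \<circ> inv_into (vars_rule R) \<pi>"]) (use undo in auto)
  moreover have "vars_rule ?S = \<pi> ` vars_rule R"
    unfolding vars_rule_def by (auto simp: vars_atom_subst_Var)
  ultimately show ?thesis
    using \<pi>(1) by (intro exI[of _ ?S]) (auto intro!: exI[of _ \<pi>])
qed

lemma bounded_imp_terminates:
  fixes P :: "('p, 'c) rule set"
  assumes inf: "infinite (UNIV :: 'c set)"
    and P: "datalog_program ar P" and run: "adornment_run id h_cont P r"
    and bounded: "bounded_program ar P"
  shows "terminates r"
proof -
  obtain Q where Q: "datalog_program ar Q" "nonrecursive Q" and eq: "equivalent_to ar P Q"
    using bounded by (auto simp: bounded_program_def)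
  have "finite Q"
    using Q(1) by (simp add: datalog_program_def)
  have "\<forall>p. \<exists>k. \<forall>I cs. (p, cs) \<in> least_interp (edb P) Q I \<longrightarrow>
    (\<exists>J \<subseteq> I. finite J \<and> card J \<le> k \<and> (p, cs) \<in> least_interp (edb P) Q J)"
    using nonrecursive_support[OF \<open>finite Q\<close> Q(2)] by blast
  from choice[OF this] obtain kf where kf: "\<And>p I cs. (p, cs) \<in> least_interp (edb P) Q I \<Longrightarrow>
    \<exists>J \<subseteq> I. finite J \<and> card J \<le> kf p \<and> (p, cs) \<in> least_interp (edb P) Q J"
    by blast
  \<comment> \<open>\<open>k\<close> bounds the support for all predicates of \<open>P\<close>,
    \<open>L\<close> all arities. A rule with at most \<open>k\<close> body atoms has at most
    \<open>Suc k\<close> atoms with its head, hence at most \<open>M\<close> variables.\<close>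
  define k where "k = (\<Sum>p \<in> preds P. kf p)"
  define L where "L = (\<Sum>p \<in> preds P. ar p)"
  define M where "M = Suc k * L"
  define T where "T = Var ` {..<M} \<union> Const ` constants P"
  define A :: "('p, 'c) atom set"
    where "A = {a. atom_pred a \<in> preds P \<and> set (atom_args a) \<subseteq> T \<and> length (atom_args a) \<le> L}"
  \<comment> \<open>Only rules that are covered at some stage enter \<open>F\<close>. So each has
    such a stage, and finiteness turns these into the single stage \<open>N\<close>.\<close>
  define F where "F = {R \<in> {R. head R \<in> A \<and> set (body R) \<subseteq> A \<and> length (body R) \<le> k}. \<exists>n. covered (r n) R}"
  have "finite T"
    using finite_constants[OF P] by (simp add: T_def)
  have "finite F"
    unfolding F_def A_def
    by (intro finite_subset[OF _ finite_rules[OF finite_preds[OF P] \<open>finite T\<close>]]) auto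
  have "\<forall>R \<in> F. \<exists>n. covered (r n) R"
    unfolding F_def by blast
  from bchoice[OF this] obtain nf where nf: "\<And>R. R \<in> F \<Longrightarrow> covered (r (nf R)) R"
    by blast
  define N where "N = (\<Sum>R \<in> F. nf R)"
  have N: "covered (r N) R" if "R \<in> F" for R
  proof -
    have "nf R \<le> N"
      unfolding N_def by (rule member_le_sum) (use that \<open>finite F\<close> in auto)
    then show ?thesis
      using nf[OF that] covered_mono run_mono[OF P run] by blast
  qed
  \<comment> \<open>\<phi> and its copy over the first \<open>M\<close> variables subsume each
    other. The copy lies in \<open>F\<close>, so it is covered at stage \<open>N\<close>, and with
    it \<phi>.\<close>
  have small: "covered (r N) \<phi>" if exp: "expansion ar P \<rho>" and cov: "covered (r n) \<phi>"
    and \<phi>: "head \<phi> = head \<rho>" "set (body \<phi>) \<subseteq> set (body \<rho>)" "length (body \<phi>) \<le> k" for \<rho> \<phi> n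
  proof -
    have atoms: "atom_pred a \<in> preds P \<and> set2_atom a \<subseteq> constants P \<and> length (atom_args a) \<le> L"
      if "a \<in> insert (head \<phi>) (set (body \<phi>))" for a
    proof -
      have "a \<in> insert (head \<rho>) (set (body \<rho>))"
        using that \<phi> by auto
      then have a: "atom_pred a \<in> preds P" "set2_atom a \<subseteq> constants P" "length (atom_args a) = ar (atom_pred a)"
        using exp by (auto simp: expansion_def edb_def)
      moreover have "ar (atom_pred a) \<le> L"
        unfolding L_def by (rule member_le_sum) (use a(1) finite_preds[OF P] in auto)
      ultimately show ?thesis by simp
    qed
    have "card (vars_rule \<phi>) \<le> Suc (length (body \<phi>)) * L"
      by (rule card_vars_rule_le) (use atoms in blast)
    also have "\<dots> \<le> M"
      unfolding M_def using \<phi>(3) by (intro mult_right_mono) auto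
    finally obtain \<phi>' \<pi> where \<phi>': "subsumes \<phi> \<phi>'" "subsumes \<phi>' \<phi>" "vars_rule \<phi>' \<subseteq> {..<M}"
      "length (body \<phi>') = length (body \<phi>)" "head \<phi>' = subst_atom (Var \<circ> \<pi>) (head \<phi>)"
      "set (body \<phi>') = subst_atom (Var \<circ> \<pi>) ` set (body \<phi>)"
      using rename_into by blast
    have "a \<in> A" if a: "a \<in> insert (head \<phi>') (set (body \<phi>'))" for a
    proof -
      obtain b where b: "a = subst_atom (Var \<circ> \<pi>) b" "b \<in> insert (head \<phi>) (set (body \<phi>))"
        using a \<phi>'(5,6) by blast
      have "set2_atom a \<subseteq> constants P"
        unfolding b(1) by (rule set2_atom_subst) (use atoms[OF b(2)] in auto)
      moreover have "vars_atom a \<subseteq> {..<M}"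
        using a \<phi>'(3) by (auto simp: vars_rule_def)
      moreover have "t \<in> T" if "vars_trm t \<subseteq> {..<M}" "set_trm t \<subseteq> constants P" for t
        using that by (cases t) (auto simp: T_def)
      ultimately have "set (atom_args a) \<subseteq> T"
        by (fastforce simp: vars_atom_def set2_atom_alt)
      then show ?thesis
        using atoms[OF b(2)] by (simp add: A_def b(1))
    qed
    then have "\<phi>' \<in> F"
      using \<phi>(3) \<phi>'(4) covered_subsumes[OF cov \<phi>'(1)] by (auto simp: F_def)
    then show ?thesis
      using N covered_subsumes \<phi>'(2) by blast
  qed
  \<comment> \<open>A resolvent that is new after stage \<open>N\<close> has a short subrule that is
    covered at some stage, hence at \<open>N\<close>. The subrule subsumes the resolvent, which was
    therefore covered before.\<close>
  have stable: "r (Suc n) = r n" if "n \<ge> N" for n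
  proof (rule ccontr)
    assume neq: "r (Suc n) \<noteq> r n"
    obtain \<rho> where exp: "expansion ar P \<rho>" and cov: "covered (r (Suc n)) \<rho>" and new: "\<not> covered (r n) \<rho>"
    proof (rule run_step[OF run, of n])
      fix R cs
      assume "choice P (r n) R cs" "process id h_cont P R cs (r n) (r (Suc n))"
      then show thesis
        by (rule process_cases[OF P run_adorned[OF P run]]) (use neq that in auto)
    qed (use neq in simp)
    have "\<exists>bs m. set bs \<subseteq> set (body \<rho>) \<and> length bs \<le> k \<and> covered (r m) (Rule (head \<rho>) bs)"
    proof (cases "atom_pred (head \<rho>) \<in> edb P")
      case True
      \<comment> \<open>\<open>covered_small_subrule\<close> excludes such heads. Here the rule is
        its own short subrule, covered as soon as it has been processed.\<close>
      then have "\<rho> = Rule (head \<rho>) []"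
        using exp by (cases \<rho>) (simp add: expansion_def)
      then have "covered (r (Suc n)) (Rule (head \<rho>) [])"
        using cov by simp
      then show ?thesis
        by (intro exI[of _ "[]"]) auto
    next
      case False
      have "kf (atom_pred (head \<rho>)) \<le> k"
        unfolding k_def
        by (rule member_le_sum) (use exp finite_preds[OF P] in \<open>auto simp: expansion_def\<close>)
      then show ?thesis
        using covered_small_subrule[OF inf P run eq kf exp False] order_trans by blast
    qed
    then obtain bs m where bs: "set bs \<subseteq> set (body \<rho>)" "length bs \<le> k" "covered (r m) (Rule (head \<rho>) bs)"
      by blast
    have "covered (r N) (Rule (head \<rho>) bs)"
      by (rule small[OF exp bs(3)]) (use bs in auto)
    moreover have "subsumes (Rule (head \<rho>) bs) \<rho>"
      unfolding subsumes_def by (intro exI[of _ Var]) (use bs(1) in auto)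
    ultimately have "covered (r n) \<rho>"
      using covered_subsumes covered_mono run_mono[OF P run that] by blast
    with new show False by contradiction
  qed
  have "r n = r N" if "n \<ge> N" for n
    using that by (induction rule: dec_induct) (auto simp: stable)
  then show ?thesis
    unfolding terminates_def by blast
qed

theorem proposition4p5:
  fixes ar :: "'p \<Rightarrow> nat" and \<Pi> :: "('p, 'c) rule set"
    and r :: "nat \<Rightarrow> ('p, 'c) arule set"
  assumes "infinite (UNIV :: 'c set)"
    and "datalog_program ar \<Pi>"
    and "adornment_run id h_cont \<Pi> r"
  shows "terminates r \<longleftrightarrow> bounded_program ar \<Pi>"
  using assms terminates_imp_bounded bounded_imp_terminates by blast

end
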